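(* Assume Conjecture A (stated in the context). Then there is an algorithm which takes as input a Diophantine equation $D(x_1,\ldots,x_p)=0$ with $D\in\mathbb{Z}[x_1,\ldots,x_p]$ and returns an integer $b$ such that, if the equation has only finitely many integer solutions, then every integer solution $(x_1,\ldots,x_p)$ satisfies $|x_1|,\ldots,|x_p|\leqslant b$. More precisely, such a bound can be computed by applying any non-negative bounding algorithm (defined, and available under Conjecture A, as explained in the context) to the equation $$\prod_{(i_1,\ldots,i_p)\in\{1,2\}^p} D\bigl((-1)^{i_1}\cdot x_1,\ldots,(-1)^{i_p}\cdot x_p\bigr)=0 .$$
   Context: $\mathbb{N}=\{0,1,2,\ldots\}$. For a positive integer $n$, let $G_n=\{x_i\cdot x_j=x_k : i,j,k\in\{1,\ldots,n\}\}\cup\{x_i+1=x_k : i,k\in\{1,\ldots,n\}\}$, a set of equations in the variables $x_1,\ldots,x_n$. Define $f(1)=1$ and $f(n+1)=2^{2^{f(n)}}$ for every positive integer $n$. Conjecture A: for every positive integer $n$, if a system $\mathcal{S}\subseteq G_n$ has only finitely many solutions in non-negative integers $x_1,\ldots,x_n$, then each such solution $(x_1,\ldots,x_n)$ satisfies $x_1,\ldots,x_n\leqslant f(2n)$. A Diophantine equation is an equation $D(x_1,\ldots,x_p)=0$ with $p\geqslant 1$ and $D\in\mathbb{Z}[x_1,\ldots,x_p]$; the list of variables is part of the data. A non-negative bounding algorithm is an algorithm which takes as input a Diophantine equation $E(x_1,\ldots,x_p)=0$ and returns an integer $b$ such that, if the equation has only finitely many solutions in $\mathbb{N}^p$, then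 every solution $(x_1,\ldots,x_p)\in\mathbb{N}^p$ satisfies $x_1,\ldots,x_p\leqslant b$. An earlier result of the paper states that Conjecture A implies that a non-negative bounding algorithm exists. *)

theory Defs
  imports "HOL-Library.Poly_Mapping" "HOL-Library.FuncSet" "HOL-Library.Nat_Bijection"
begin

section \<open>The equations of \<open>G\<^sub>n\<close> and Conjecture A\<close>

text \<open>\<open>Mult_eq i j k\<close> is the equation \<open>x\<^sub>i \<cdot> x\<^sub>j = x\<^sub>k\<close>, and
  \<open>Succ_eq i k\<close> is the equation \<open>x\<^sub>i + 1 = x\<^sub>k\<close>.\<close>

datatype basic_eq = Mult_eq nat nat nat | Succ_eq nat nat

definition G :: "nat \<Rightarrow> basic_eq set" where
  "G n = {Mult_eq i j k |i j k. i \<in> {1..n} \<and> j \<in> {1..n} \<and> k \<in> {1..n}} \<union>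
         {Succ_eq i k |i k. i \<in> {1..n} \<and> k \<in> {1..n}}"

fun satisfies :: "(nat \<Rightarrow> nat) \<Rightarrow> basic_eq \<Rightarrow> bool" where
  "satisfies x (Mult_eq i j k) \<longleftrightarrow> x i * x j = x k"
| "satisfies x (Succ_eq i k) \<longleftrightarrow> x i + 1 = x k"

text \<open>An \<open>n\<close>-tuple is an extensional function on \<open>{1..n}\<close>, so that finiteness of a
  set of tuples has its usual meaning.\<close>

definition system_solutions :: "nat \<Rightarrow> basic_eq set \<Rightarrow> (nat \<Rightarrow> nat) set" where
  "system_solutions n S = {x \<in> {1..n} \<rightarrow>\<^sub>E UNIV. \<forall>e\<in>S. satisfies x e}"

text \<open>Only positive arguments matter; the value at \<open>0\<close> is a dummy.\<close>

fun f :: "nat \<Rightarrow> nat" where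
  "f 0 = 0"
| "f (Suc 0) = 1"
| "f (Suc (Suc n)) = 2 ^ (2 ^ f (Suc n))"

definition conjecture_A :: bool where
  "conjecture_A \<longleftrightarrow>
     (\<forall>n\<ge>1. \<forall>S\<subseteq>G n. finite (system_solutions n S) \<longrightarrow>
        (\<forall>x\<in>system_solutions n S. \<forall>i\<in>{1..n}. x i \<le> f (2 * n)))"


section \<open>Diophantine equations\<close>

text \<open>Finitely supported maps from exponent vectors to coefficients; the ring structure
  is the convolution ring of \<open>Poly_Mapping\<close>.\<close>

type_synonym int_mpoly = "(nat \<Rightarrow>\<^sub>0 nat) \<Rightarrow>\<^sub>0 int"

abbreviation (input) "keys \<equiv> Poly_Mapping.keys"
abbreviation (input) "lookup \<equiv> Poly_Mapping.lookup"

definition Var :: "nat \<Rightarrow> int_mpoly" where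
  "Var k = Poly_Mapping.single (Poly_Mapping.single k 1) 1"

definition vars :: "int_mpoly \<Rightarrow> nat set" where
  "vars D = (\<Union>m\<in>keys D. keys m)"

text \<open>The value \<open>D(g\<^sub>1, g\<^sub>2, \<dots>)\<close> in an arbitrary commutative ring: for \<open>'a = int\<close> this
  is evaluation, for \<open>'a = int_mpoly\<close> it is substitution of polynomials.\<close>

definition insertion :: "(nat \<Rightarrow> 'a::comm_ring_1) \<Rightarrow> int_mpoly \<Rightarrow> 'a" where
  "insertion g D =
     (\<Sum>m\<in>keys D. of_int (lookup D m) * (\<Prod>i\<in>keys m. g i ^ lookup m i))"

text \<open>The pair \<open>(p, D)\<close> stands for the equation \<open>D(x\<^sub>1, \<dots>, x\<^sub>p) = 0\<close>.\<close>

type_synonym equation = "nat \<times> int_mpoly"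

definition diophantine :: "equation \<Rightarrow> bool" where
  "diophantine E \<longleftrightarrow> fst E \<ge> 1 \<and> vars (snd E) \<subseteq> {1..fst E}"

definition solutions :: "int set \<Rightarrow> equation \<Rightarrow> (nat \<Rightarrow> int) set" where
  "solutions R E = {x \<in> {1..fst E} \<rightarrow>\<^sub>E R. insertion x (snd E) = 0}"

definition sign_product :: "equation \<Rightarrow> equation" where
  "sign_product E =
     (fst E, \<Prod>s\<in>{1..fst E} \<rightarrow>\<^sub>E {1, 2::nat}.
               insertion (\<lambda>k. (- 1) ^ s k * Var k) (snd E))"

lemma vars_add: "vars (D + E) \<subseteq> vars D \<union> vars E"
  unfolding vars_def using keys_add[of D E] by blast

lemma vars_mult: "vars (D * E) \<subseteq> vars D \<union> vars E"
proof
  fix i assume "i \<in> vars (D * E)"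
  then obtain m where m: "m \<in> keys (D * E)" "i \<in> keys m"
    by (auto simp: vars_def)
  then obtain a b where "a \<in> keys D" "b \<in> keys E" "m = a + b"
    using keys_mult[of D E] by blast
  with m(2) show "i \<in> vars D \<union> vars E"
    using keys_add[of a b] by (auto simp: vars_def)
qed

lemma vars_0: "vars 0 = {}" and vars_1: "vars 1 = {}"
  by (simp_all add: vars_def)

lemma vars_uminus: "vars (- D) = vars D"
  by (simp add: vars_def)

lemma vars_of_int: "vars (of_int c) = {}"
proof -
  have "vars (of_nat n) = {}" for n
  proof (induction n)
    case (Suc n)
    then show ?case using vars_add[of 1 "of_nat n"] by (simp add: vars_1)
  qed (simp add: vars_0)
  then show ?thesis
    by (cases c) (auto simp: vars_uminus simp del: of_nat_Suc)
qed

lemma vars_sum: "(\<And>a. a \<in> A \<Longrightarrow> vars (g a) \<subseteq> V) \<Longrightarrow> vars (sum g A) \<subseteq> V"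
proof (induction A rule: infinite_finite_induct)
  case (insert a A)
  then show ?case using vars_add[of "g a" "sum g A"] by auto
qed (simp_all add: vars_0)

lemma vars_prod: "(\<And>a. a \<in> A \<Longrightarrow> vars (g a) \<subseteq> V) \<Longrightarrow> vars (prod g A) \<subseteq> V"
proof (induction A rule: infinite_finite_induct)
  case (insert a A)
  then show ?case using vars_mult[of "g a" "prod g A"] by auto
qed (simp_all add: vars_1)

lemma vars_power: "vars (D ^ n) \<subseteq> vars D"
proof (induction n)
  case (Suc n)
  then show ?case using vars_mult[of D "D ^ n"] by auto
qed (simp add: vars_1)

lemma vars_sign_Var: "vars ((- 1) ^ n * Var k) \<subseteq> {k}"
proof -
  have "vars (Var k) \<subseteq> {k}"
    by (auto simp: vars_def Var_def)
  then show ?thesis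
    using vars_mult[of "(- 1) ^ n" "Var k"] vars_power[of "- 1" n]
    by (auto simp: vars_uminus vars_1)
qed

lemma diophantine_sign_product:
  assumes "diophantine E"
  shows "diophantine (sign_product E)"
proof -
  have "vars (insertion (\<lambda>k. (- 1) ^ s k * Var k) (snd E)) \<subseteq> {1..fst E}" for s :: "nat \<Rightarrow> nat"
    unfolding insertion_def
  proof (rule vars_sum)
    fix m assume m: "m \<in> keys (snd E)"
    have "vars (\<Prod>i\<in>keys m. ((- 1) ^ s i * Var i) ^ lookup m i) \<subseteq> {1..fst E}"
    proof (rule vars_prod)
      fix i assume "i \<in> keys m"
      with m assms have "i \<in> {1..fst E}"
        by (auto simp: diophantine_def vars_def)
      then show "vars (((- 1) ^ s i * Var i) ^ lookup m i) \<subseteq> {1..fst E}"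
        using vars_power vars_sign_Var by blast
    qed
    then show "vars (of_int (lookup (snd E) m) *
        (\<Prod>i\<in>keys m. ((- 1) ^ s i * Var i) ^ lookup m i)) \<subseteq> {1..fst E}"
      using vars_mult vars_of_int by blast
  qed
  then have "vars (snd (sign_product E)) \<subseteq> {1..fst E}"
    unfolding sign_product_def snd_conv by (intro vars_prod)
  then show ?thesis
    using assms by (simp add: diophantine_def sign_product_def)
qed


section \<open>Algorithms\<close>

text \<open>Partial recursive functions, as programs with a big-step semantics:
  \<open>evaluates r xs y\<close> says that \<open>r\<close> halts on the arguments \<open>xs\<close> with result \<open>y\<close>.
  The recursion argument of \<open>Prim_rec\<close> and the search argument of \<open>Minimize\<close> come first.\<close>

datatype recfun =
    Zero
  | Succ
  | Proj nat
  | Compose recfun "recfun list"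
  | Prim_rec recfun recfun
  | Minimize recfun

inductive evaluates :: "recfun \<Rightarrow> nat list \<Rightarrow> nat \<Rightarrow> bool" where
  zero: "evaluates Zero xs 0"
| succ: "evaluates Succ [x] (Suc x)"
| proj: "i < length xs \<Longrightarrow> evaluates (Proj i) xs (xs ! i)"
| compose: "list_all2 (\<lambda>g y. evaluates g xs y) gs ys \<Longrightarrow> evaluates h ys z \<Longrightarrow>
    evaluates (Compose h gs) xs z"
| prim_rec_0: "evaluates g xs y \<Longrightarrow> evaluates (Prim_rec g h) (0 # xs) y"
| prim_rec_Suc: "evaluates (Prim_rec g h) (n # xs) y \<Longrightarrow> evaluates h (n # y # xs) z \<Longrightarrow>
    evaluates (Prim_rec g h) (Suc n # xs) z"
| minimize: "evaluates g (n # xs) 0 \<Longrightarrow> (\<And>m. m < n \<Longrightarrow> \<exists>y. evaluates g (m # xs) (Suc y)) \<Longrightarrow>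
    evaluates (Minimize g) xs n"

inductive_cases evaluates_elims:
  "evaluates Zero xs z" "evaluates Succ xs z" "evaluates (Proj i) xs z"
  "evaluates (Compose h gs) xs z" "evaluates (Prim_rec g h) (0 # xs) z"
  "evaluates (Prim_rec g h) (Suc n # xs) z" "evaluates (Minimize g) xs z"

lemma evaluates_unique: "evaluates r xs y \<Longrightarrow> evaluates r xs z \<Longrightarrow> y = z"
proof (induction arbitrary: z rule: evaluates.induct)
  case (compose xs gs ys h w)
  from compose.prems obtain ys' where ys': "list_all2 (\<lambda>g y. evaluates g xs y) gs ys'"
    "evaluates h ys' z"
    by (rule evaluates_elims)
  have "ys' = ys"
    using compose.IH(1) ys'(1)
  proof (induction arbitrary: ys' rule: list_all2_induct)
    case Nil
    then show ?case by simp
  next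
    case (Cons g gs y ys)
    from Cons.prems obtain y' ys'' where "ys' = y' # ys''" "evaluates g xs y'"
      "list_all2 (\<lambda>g y. evaluates g xs y) gs ys''"
      unfolding list_all2_Cons1 by (elim exE conjE) (rule that)
    with Cons.hyps(1) Cons.IH show ?case by simp
  qed
  then show ?case
    using compose.IH(2) ys'(2) by simp
next
  case (prim_rec_Suc g h n xs y z w)
  from prim_rec_Suc.prems obtain y' where "evaluates (Prim_rec g h) (n # xs) y'"
    "evaluates h (n # y' # xs) w"
    by (rule evaluates_elims)
  with prim_rec_Suc.IH show ?case by simp
next
  case (minimize g n xs)
  have z: "evaluates g (z # xs) 0"
    "\<And>m. m < z \<Longrightarrow> \<exists>y. evaluates g (m # xs) (Suc y)"
    by (rule evaluates_elims(7)[OF minimize.prems], assumption,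
        rule evaluates_elims(7)[OF minimize.prems], blast)
  have "\<not> z < n" using minimize.IH(2) z(1) by blast
  moreover have "\<not> n < z" using minimize.IH(1) z(2) by blast
  ultimately show ?case by simp
qed (erule evaluates_elims; simp)+

text \<open>Canonical codes: a finitely supported map is coded by the code of its finite graph,
  so that equal polynomials have equal codes.\<close>

definition code_monom :: "(nat \<Rightarrow>\<^sub>0 nat) \<Rightarrow> nat" where
  "code_monom m = set_encode ((\<lambda>i. prod_encode (i, lookup m i)) ` keys m)"

definition code_mpoly :: "int_mpoly \<Rightarrow> nat" where
  "code_mpoly D =
     set_encode ((\<lambda>m. prod_encode (code_monom m, int_encode (lookup D m))) ` keys D)"

definition code_equation :: "equation \<Rightarrow> nat" where
  "code_equation E = prod_encode (fst E, code_mpoly (snd E))"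

lemma graph_code_inj:
  fixes F F' :: "'a \<Rightarrow>\<^sub>0 'b::zero"
  assumes "inj c" "inj d"
    and "set_encode ((\<lambda>k. prod_encode (c k, d (lookup F k))) ` keys F) =
         set_encode ((\<lambda>k. prod_encode (c k, d (lookup F' k))) ` keys F')"
  shows "F = F'"
proof -
  have img: "(\<lambda>k. prod_encode (c k, d (lookup F k))) ` keys F =
      (\<lambda>k. prod_encode (c k, d (lookup F' k))) ` keys F'"
    using arg_cong[OF assms(3), of set_decode] by simp
  have 1: "lookup F' k = lookup F k" if "k \<in> keys F" for k
  proof -
    from that have "prod_encode (c k, d (lookup F k)) \<in>
        (\<lambda>k. prod_encode (c k, d (lookup F' k))) ` keys F'"
      unfolding img[symmetric] by (intro imageI)
    then obtain k' where "c k = c k'" "d (lookup F k) = d (lookup F' k')"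
      by (auto simp: prod_encode_eq)
    then show ?thesis
      using injD[OF assms(1)] injD[OF assms(2)] by metis
  qed
  have 2: "lookup F k = lookup F' k" if "k \<in> keys F'" for k
  proof -
    from that have "prod_encode (c k, d (lookup F' k)) \<in>
        (\<lambda>k. prod_encode (c k, d (lookup F k))) ` keys F"
      unfolding img by (intro imageI)
    then obtain k' where "c k = c k'" "d (lookup F' k) = d (lookup F k')"
      by (auto simp: prod_encode_eq)
    then show ?thesis
      using injD[OF assms(1)] injD[OF assms(2)] by metis
  qed
  show ?thesis
  proof (rule poly_mapping_eqI)
    fix k
    show "lookup F k = lookup F' k"
      using 1[of k] 2[of k] unfolding in_keys_iff by (cases "lookup F k = 0") auto
  qed
qed

lemma code_equation_inj: "inj code_equation"
proof -
  have m: "inj code_monom"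
    by (rule injI, unfold code_monom_def, rule graph_code_inj[where c = id and d = id]) simp_all
  have p: "inj code_mpoly"
    by (rule injI, unfold code_mpoly_def,
        rule graph_code_inj[where c = code_monom and d = int_encode])
       (simp_all add: m inj_int_encode)
  show ?thesis
    by (rule injI) (simp add: code_equation_def prod_encode_eq prod_eq_iff inj_eq[OF p])
qed

definition computable :: "(equation \<Rightarrow> int) \<Rightarrow> bool" where
  "computable A \<longleftrightarrow>
     (\<exists>r. \<forall>E. diophantine E \<longrightarrow> evaluates r [code_equation E] (int_encode (A E)))"

definition nonneg_bounding_algorithm :: "(equation \<Rightarrow> int) \<Rightarrow> bool" where
  "nonneg_bounding_algorithm A \<longleftrightarrow> computable A \<and>
     (\<forall>E. diophantine E \<longrightarrow> finite (solutions \<nat> E) \<longrightarrow>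
        (\<forall>x\<in>solutions \<nat> E. \<forall>i\<in>{1..fst E}. x i \<le> A E))"

definition integer_bounding_algorithm :: "(equation \<Rightarrow> int) \<Rightarrow> bool" where
  "integer_bounding_algorithm A \<longleftrightarrow> computable A \<and>
     (\<forall>E. diophantine E \<longrightarrow> finite (solutions UNIV E) \<longrightarrow>
        (\<forall>x\<in>solutions UNIV E. \<forall>i\<in>{1..fst E}. \<bar>x i\<bar> \<le> A E))"

end

theory Submission
  imports Defs
begin

text \<open>The integer zeros of \<open>D\<close> are controlled by the nonnegative zeros of its sign product.  A tuple
\<open>x\<close> of natural numbers is a zero of the product iff some factor vanishes at \<open>x\<close>, that is, iff
\<open>x\<close> becomes a zero of \<open>D\<close> after changing the signs of some coordinates.  So the nonnegative
zeros of the product are exactly the tuples of absolute values of integer zeros of \<open>D\<close>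
(\<open>solutions_sign_product\<close>): there are finitely many if \<open>D\<close> has finitely many integer zeros,
and a bound for them is a bound for all \<open>\<bar>x\<^sub>i\<bar>\<close>.  Two points remain.

The map that sends \<open>D\<close> to its sign product must be computable on codes
(\<open>computable_sign_product\<close>).  The product over all \<open>2\<^sup>p\<close> sign patterns is built in \<open>p\<close> steps:
if \<open>Q\<close> is the product over the sign changes of the first \<open>k\<close> unknowns, then the next product is
\<open>Q\<close> times the polynomial obtained from \<open>Q\<close> by negating the unknown \<open>k + 1\<close>.  The code of a
polynomial is the sum of \<open>2\<^sup>j\<close> over the codes \<open>j\<close> of the pairs of a monomial and its coefficient,
so one step can be written with bounded sums over the bits of codes
(\<open>times_flip_code_mpoly\<close>).  Each of these sums is recursive, and so is the iteration.

A nonnegative bounding algorithm must exist under Conjecture A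
(\<open>nonneg_bounding_algorithm_unknowns_bound\<close>).  Write \<open>D = P - N\<close> with \<open>P\<close> and \<open>N\<close> having
nonnegative coefficients, and write \<open>P\<close> and \<open>N\<close> as arithmetic expressions.  One unknown for each
subexpression turns \<open>P = N\<close> into a system of equations of the two permitted shapes.  The only
obstacle is addition, which Robinson's identity expresses by products and successors
(\<open>robinson_addition\<close>).  In this system the unknowns of \<open>D\<close> determine all the others, so the
system has finitely many solutions iff the equation has, and Conjecture A applies
(\<open>expr_equation_bound\<close>).  The number of unknowns need not be computed exactly: as \<open>f\<close> is
monotone, any recursive upper bound for it is enough, and a polynomial in the code of \<open>D\<close> is one.\<close>

section \<open>Evaluation as a ring homomorphism\<close>

abbreviation monom_value :: "(nat \<Rightarrow> 'a::comm_ring_1) \<Rightarrow> (nat \<Rightarrow>\<^sub>0 nat) \<Rightarrow> 'a" where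
  "monom_value g m \<equiv> (\<Prod>i\<in>keys m. g i ^ lookup m i)"

lemma monom_value_superset:
  assumes "finite I" "keys m \<subseteq> I"
  shows "monom_value g m = (\<Prod>i\<in>I. g i ^ lookup m i)"
  using assms by (intro prod.mono_neutral_left) (auto simp: in_keys_iff)

lemma monom_value_add: "monom_value g (a + b) = monom_value g a * monom_value g b"
proof -
  let ?I = "keys a \<union> keys b"
  have "monom_value g (a + b) = (\<Prod>i\<in>?I. g i ^ lookup (a + b) i)"
    by (rule monom_value_superset) (use keys_add[of a b] in auto)
  also have "\<dots> = (\<Prod>i\<in>?I. g i ^ lookup a i) * (\<Prod>i\<in>?I. g i ^ lookup b i)"
    by (simp add: lookup_add power_add prod.distrib)
  also have "\<dots> = monom_value g a * monom_value g b"
    by (simp add: monom_value_superset[of ?I])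
  finally show ?thesis .
qed

lemma insertion_superset:
  assumes "finite M" "keys D \<subseteq> M"
  shows "insertion g D = (\<Sum>m\<in>M. of_int (lookup D m) * monom_value g m)"
  unfolding insertion_def
  using assms by (intro sum.mono_neutral_left) (auto simp: in_keys_iff)

lemma insertion_add: "insertion g (C + D) = insertion g C + insertion g D"
proof -
  let ?M = "keys C \<union> keys D"
  have "insertion g (C + D) = (\<Sum>m\<in>?M. of_int (lookup (C + D) m) * monom_value g m)"
    by (rule insertion_superset) (use keys_add[of C D] in auto)
  also have "\<dots> = (\<Sum>m\<in>?M. of_int (lookup C m) * monom_value g m) +
      (\<Sum>m\<in>?M. of_int (lookup D m) * monom_value g m)"
    by (simp add: lookup_add algebra_simps sum.distrib)
  also have "\<dots> = insertion g C + insertion g D"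
    by (simp add: insertion_superset[of ?M])
  finally show ?thesis .
qed

lemma insertion_single: "insertion g (Poly_Mapping.single m c) = of_int c * monom_value g m"
  by (subst insertion_superset[of "{m}"]) auto

lemma insertion_0: "insertion g 0 = 0"
  by (simp add: insertion_def)

lemma insertion_sum: "insertion g (sum F A) = (\<Sum>a\<in>A. insertion g (F a))"
  by (induction A rule: infinite_finite_induct) (simp_all add: insertion_0 insertion_add)

text \<open>Sums of single terms make products, substitutions and coefficients accessible by linearity.\<close>

lemma poly_mapping_eq_sum_single:
  fixes D :: "'a \<Rightarrow>\<^sub>0 'b::comm_monoid_add"
  shows "D = (\<Sum>m\<in>keys D. Poly_Mapping.single m (lookup D m))"
proof (rule poly_mapping_eqI)
  fix k
  have "lookup (\<Sum>m\<in>keys D. Poly_Mapping.single m (lookup D m)) k =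
      (\<Sum>m\<in>keys D. if m = k then lookup D k else 0)"
    by (auto simp: lookup_sum lookup_single when_def intro: sum.cong)
  then show "lookup D k = lookup (\<Sum>m\<in>keys D. Poly_Mapping.single m (lookup D m)) k"
    by (simp add: in_keys_iff)
qed

lemma times_eq_sum_single:
  fixes C D :: int_mpoly
  shows "C * D = (\<Sum>a\<in>keys C. \<Sum>b\<in>keys D. Poly_Mapping.single (a + b) (lookup C a * lookup D b))"
  by (subst poly_mapping_eq_sum_single[of C], subst poly_mapping_eq_sum_single[of D])
     (simp add: sum_product mult_single)

lemma insertion_mult: "insertion g (C * D) = insertion g C * insertion g D"
proof -
  have "insertion g (C * D) = (\<Sum>a\<in>keys C. \<Sum>b\<in>keys D.
      of_int (lookup C a) * monom_value g a * (of_int (lookup D b) * monom_value g b))"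
    unfolding times_eq_sum_single insertion_sum insertion_single monom_value_add
    by (simp add: mult_ac)
  then show ?thesis
    unfolding insertion_def by (simp add: sum_product)
qed

lemma of_int_eq_single: "(of_int c :: int_mpoly) = Poly_Mapping.single 0 c"
proof -
  have "Poly_Mapping.single 0 (of_int c :: int) = (of_int c :: int_mpoly)" by (rule single_of_int)
  then show ?thesis by simp
qed

lemma insertion_of_int: "insertion g (of_int c) = of_int c"
  by (simp add: of_int_eq_single insertion_single)

lemma insertion_1: "insertion g 1 = 1"
  using insertion_of_int[of g 1] by simp

lemma insertion_prod: "insertion g (prod F A) = (\<Prod>a\<in>A. insertion g (F a))"
  by (induction A rule: infinite_finite_induct) (simp_all add: insertion_1 insertion_mult)

lemma insertion_power: "insertion g (D ^ n) = insertion g D ^ n"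
  by (induction n) (simp_all add: insertion_1 insertion_mult)

lemma insertion_Var: "insertion g (Var k) = g k"
  by (simp add: Var_def insertion_single)

text \<open>Substituting polynomials and then evaluating is evaluating at the values of these polynomials.
It serves both to find the zeros of the sign product and to compose two sign changes.\<close>

lemma insertion_insertion:
  "insertion g (insertion h D) = insertion (\<lambda>i. insertion g (h i)) D"
  unfolding insertion_def[of h] insertion_def[of "\<lambda>i. insertion g (h i)"]
  by (simp add: insertion_sum insertion_mult insertion_of_int insertion_prod insertion_power)

lemma insertion_cong:
  assumes "\<And>i. i \<in> vars D \<Longrightarrow> g i = h i"
  shows "insertion g D = insertion h D"
proof -
  have "g i = h i" if "m \<in> keys D" "i \<in> keys m" for m i
    using that assms by (auto simp: vars_def)
  then show ?thesis
    unfolding insertion_def by (intro sum.cong refl arg_cong2[of _ _ _ _ "(*)"] prod.cong) auto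
qed

text \<open>The monomial with exponents \<open>m\<close>, computed in the ring of polynomials, is the term with key \<open>m\<close>;
hence substituting each unknown for itself changes nothing.\<close>

lemma monom_value_Var: "monom_value Var m = Poly_Mapping.single m 1"
proof -
  have power: "Var i ^ e = Poly_Mapping.single (Poly_Mapping.single i e) 1" for i e
    by (induction e) (simp_all add: Var_def mult_single flip: single_add)
  have "(\<Prod>i\<in>I. Poly_Mapping.single (F i) 1) = Poly_Mapping.single (sum F I) (1::int)"
    for F :: "nat \<Rightarrow> (nat \<Rightarrow>\<^sub>0 nat)" and I
    by (induction I rule: infinite_finite_induct) (simp_all add: mult_single)
  then show ?thesis
    unfolding power by (simp flip: poly_mapping_eq_sum_single)
qed

section \<open>The sign product as an iterated product\<close>

definition flip :: "nat \<Rightarrow> int_mpoly \<Rightarrow> int_mpoly" where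
  "flip k D = insertion (\<lambda>i. if i = k then - Var i else Var i) D"

text \<open>Negating the unknown \<open>k\<close> acts on coefficients only: an odd exponent of \<open>k\<close> changes the sign.
In this form \<open>flip\<close> can be carried out on codes.\<close>

lemma flip_eq_sum_single:
  "flip k D = (\<Sum>m\<in>keys D. Poly_Mapping.single m ((- 1) ^ lookup m k * lookup D m))"
proof -
  have mv: "monom_value (\<lambda>i. if i = k then - Var i else Var i) m =
      of_int ((- 1) ^ lookup m k) * Poly_Mapping.single m 1" for m
  proof -
    have "monom_value (\<lambda>i. if i = k then - Var i else Var i) m =
        (\<Prod>i\<in>keys m. (if i = k then (- 1) ^ lookup m i else 1) * Var i ^ lookup m i)"
      by (intro prod.cong) (auto simp: power_minus[of "Var _"])
    also have "\<dots> = (\<Prod>i\<in>keys m. if i = k then (- 1) ^ lookup m i else 1) * monom_value Var m"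
      by (rule prod.distrib)
    also have "(\<Prod>i\<in>keys m. if i = k then (- 1) ^ lookup m i else 1) = (of_int ((- 1) ^ lookup m k) :: int_mpoly)"
      by (auto simp: prod.delta in_keys_iff)
    finally show ?thesis by (simp only: monom_value_Var)
  qed
  have "of_int c * (of_int s * Poly_Mapping.single m 1) = Poly_Mapping.single m (s * c)"
    for c s :: int and m :: "nat \<Rightarrow>\<^sub>0 nat"
    by (simp add: of_int_eq_single mult_single mult.commute)
  then show ?thesis
    unfolding flip_def insertion_def mv by (simp only:)
qed

lemma lookup_times_flip:
  "lookup (C * flip k C) m = (\<Sum>a\<in>keys C. \<Sum>b\<in>keys C.
     if a + b = m then lookup C a * ((- 1) ^ lookup b k * lookup C b) else 0)"
proof -
  have "C * flip k C = (\<Sum>a\<in>keys C. \<Sum>b\<in>keys C.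
      Poly_Mapping.single (a + b) (lookup C a * ((- 1) ^ lookup b k * lookup C b)))"
    unfolding flip_eq_sum_single
    by (subst poly_mapping_eq_sum_single[of C]) (simp add: sum_product mult_single)
  then show ?thesis by (simp add: lookup_sum lookup_single when_def)
qed

text \<open>The factors in which only the first \<open>k\<close> unknowns change their signs; the intermediate values of
the recursion that computes the sign product.\<close>

definition partial_sign_product :: "nat \<Rightarrow> int_mpoly \<Rightarrow> int_mpoly" where
  "partial_sign_product k D = (\<Prod>s\<in>{1..k} \<rightarrow>\<^sub>E {1, 2::nat}.
     insertion (\<lambda>i. (if i \<in> {1..k} then (- 1) ^ s i else 1) * Var i) D)"

lemma partial_sign_product_0: "partial_sign_product 0 D = D"
proof -
  have "insertion Var D = D"
    unfolding insertion_def monom_value_Var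
    by (simp add: of_int_eq_single mult_single flip: poly_mapping_eq_sum_single)
  then show ?thesis by (simp add: partial_sign_product_def)
qed

text \<open>Split the sign patterns on \<open>{1..k + 1}\<close> according to the last sign.  The exponent \<open>2\<close> leaves the
unknown \<open>k + 1\<close> as it is, and the exponent \<open>1\<close> negates it in every factor.\<close>

lemma partial_sign_product_Suc:
  "partial_sign_product (Suc k) D = partial_sign_product k D * flip (Suc k) (partial_sign_product k D)"
proof -
  let ?V = "\<lambda>k s i. (if i \<in> {1..k} then (- 1) ^ s i else 1) * Var i"
  let ?P = "{1..k} \<rightarrow>\<^sub>E {1, 2::nat}"
  have ins: "{1..Suc k} \<rightarrow>\<^sub>E {1, 2::nat} = (\<lambda>(y, g). g(Suc k := y)) ` ({1, 2} \<times> ?P)"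
    by (simp add: atLeastAtMostSuc_conv PiE_insert_eq)
  have inj: "inj_on (\<lambda>(y, g). g(Suc k := y)) ({1, 2::nat} \<times> ?P)"
    using inj_combinator[of "Suc k" "{1..k}" "\<lambda>_. {1, 2::nat}"] by simp
  have "partial_sign_product (Suc k) D =
      (\<Prod>(y, s)\<in>{1, 2} \<times> ?P. insertion (?V (Suc k) (s(Suc k := y))) D)"
    unfolding partial_sign_product_def ins by (subst prod.reindex[OF inj]) (simp add: case_prod_unfold o_def)
  also have "\<dots> = (\<Prod>s\<in>?P. insertion (?V (Suc k) (s(Suc k := Suc 0))) D) *
      (\<Prod>s\<in>?P. insertion (?V (Suc k) (s(Suc k := 2))) D)"
    by (simp flip: prod.cartesian_product)
  also have "(\<Prod>s\<in>?P. insertion (?V (Suc k) (s(Suc k := 2))) D) = partial_sign_product k D"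
    unfolding partial_sign_product_def
    by (intro prod.cong refl arg_cong2[of _ _ _ _ insertion]) (auto simp: le_Suc_eq)
  also have "(\<Prod>s\<in>?P. insertion (?V (Suc k) (s(Suc k := Suc 0))) D) = flip (Suc k) (partial_sign_product k D)"
    unfolding partial_sign_product_def flip_def insertion_prod insertion_insertion
  proof (intro prod.cong refl arg_cong2[of _ _ _ _ insertion] ext)
    fix s :: "nat \<Rightarrow> nat" and i
    let ?g = "\<lambda>i. if i = Suc k then - Var i else Var i"
    have "insertion ?g ((if i \<in> {1..k} then (- 1) ^ s i else 1) * Var i) =
        insertion ?g (of_int (if i \<in> {1..k} then (- 1) ^ s i else 1) * Var i)"
      by (simp only: of_int_power of_int_minus of_int_1 if_distrib)
    also have "\<dots> = of_int (if i \<in> {1..k} then (- 1) ^ s i else 1) * ?g i"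
      by (simp only: insertion_mult insertion_of_int insertion_Var)
    finally show "?V (Suc k) (s(Suc k := Suc 0)) i = insertion ?g (?V k s i)"
      by (auto simp: le_Suc_eq)
  qed
  finally show ?thesis by (simp add: mult.commute)
qed

lemma sign_product_eq_partial:
  assumes "diophantine E"
  shows "snd (sign_product E) = partial_sign_product (fst E) (snd E)"
  unfolding sign_product_def partial_sign_product_def snd_conv
  using assms by (intro prod.cong refl insertion_cong) (auto simp: diophantine_def)

section \<open>Integer solutions and nonnegative solutions of the sign product\<close>

text \<open>If the factor with signs \<open>s\<close> vanishes at \<open>x\<close>, then giving the signs \<open>s\<close> to the coordinates of \<open>x\<close>
yields an integer zero of \<open>D\<close> with absolute values \<open>x\<close>.  Conversely, an integer zero \<open>y\<close> makes the factor vanish whose signs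
are those of \<open>y\<close>.\<close>

lemma solutions_sign_product:
  assumes "diophantine E"
  shows "solutions \<nat> (sign_product E) = (\<lambda>y. \<lambda>i\<in>{1..fst E}. \<bar>y i\<bar>) ` solutions UNIV E"
proof -
  let ?I = "{1..fst E}" and ?D = "snd E"
  let ?S = "?I \<rightarrow>\<^sub>E {1, 2::nat}"
  have fst: "fst (sign_product E) = fst E" by (simp add: sign_product_def)
  have ins: "insertion x (snd (sign_product E)) = (\<Prod>s\<in>?S. insertion (\<lambda>i. (- 1) ^ s i * x i) ?D)"
    for x :: "nat \<Rightarrow> int"
  proof -
    have "insertion x ((- 1) ^ n * Var i) = (- 1) ^ n * x i" for n i
      using insertion_of_int[of x "(- 1) ^ n"] by (simp add: insertion_mult insertion_Var)
    then show ?thesis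
      unfolding sign_product_def snd_conv insertion_prod insertion_insertion by simp
  qed
  have fin: "finite ?S" by (intro finite_PiE) auto
  have cong: "insertion g ?D = insertion h ?D" if "\<And>i. i \<in> ?I \<Longrightarrow> g i = h i" for g h :: "nat \<Rightarrow> int"
    using assms that by (intro insertion_cong) (auto simp: diophantine_def)
  show ?thesis
  proof (intro set_eqI iffI)
    fix x assume x: "x \<in> solutions \<nat> (sign_product E)"
    then have xP: "x \<in> ?I \<rightarrow>\<^sub>E \<nat>" and "insertion x (snd (sign_product E)) = 0"
      unfolding solutions_def fst by blast+
    then have "\<exists>s\<in>?S. insertion (\<lambda>i. (- 1) ^ s i * x i) ?D = 0"
      unfolding ins prod_zero_iff[OF fin] by blast
    then obtain s where s: "insertion (\<lambda>i. (- 1) ^ s i * x i) ?D = 0" by blast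
    let ?y = "\<lambda>i\<in>?I. (- 1) ^ s i * x i"
    have "insertion ?y ?D = 0"
      using s cong[of ?y "\<lambda>i. (- 1) ^ s i * x i"] by simp
    then have "?y \<in> solutions UNIV E" by (simp add: solutions_def)
    moreover have "x = (\<lambda>i\<in>?I. \<bar>?y i\<bar>)"
    proof
      fix i
      show "x i = (\<lambda>i\<in>?I. \<bar>?y i\<bar>) i"
      proof (cases "i \<in> ?I")
        case True
        then have "x i \<in> \<nat>" by (rule PiE_mem[OF xP])
        then have "x i \<ge> 0" by (auto elim: Nats_cases)
        with True show ?thesis by (simp add: abs_mult)
      next
        case False
        then show ?thesis using PiE_arb[OF xP False] by (simp only: restrict_apply if_False)
      qed
    qed
    ultimately show "x \<in> (\<lambda>y. \<lambda>i\<in>?I. \<bar>y i\<bar>) ` solutions UNIV E" by blast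
  next
    fix x assume "x \<in> (\<lambda>y. \<lambda>i\<in>?I. \<bar>y i\<bar>) ` solutions UNIV E"
    then obtain y where x: "x = (\<lambda>i\<in>?I. \<bar>y i\<bar>)" and y: "insertion y ?D = 0"
      by (auto simp: solutions_def)
    let ?s = "\<lambda>i\<in>?I. if y i < 0 then 1 else 2::nat"
    have "insertion (\<lambda>i. (- 1) ^ ?s i * x i) ?D = insertion y ?D"
      by (rule cong) (simp add: x)
    then have zero: "insertion (\<lambda>i. (- 1) ^ ?s i * x i) ?D = 0" using y by simp
    have "?s \<in> ?S" by (simp add: PiE_iff)
    then have "insertion x (snd (sign_product E)) = 0"
      unfolding ins using zero by (intro prod_zero[OF fin] bexI)
    moreover have "\<bar>z\<bar> \<in> \<nat>" for z :: int
      by (metis abs_ge_zero of_nat_in_Nats zero_le_imp_eq_int)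
    then have "x \<in> ?I \<rightarrow>\<^sub>E \<nat>" by (simp add: x PiE_iff)
    ultimately show "x \<in> solutions \<nat> (sign_product E)"
      unfolding solutions_def fst by blast
  qed
qed

section \<open>Recursive functions\<close>

text \<open>In the closure rules below an argument list plays the part of an environment: \<open>hd xs\<close>, \<open>hd (tl xs)\<close>,
and so on are its variables, and a binder pushes its bound variable to the front.  A recursiveness
proof is then a syntax-directed application of \<open>rec_intros\<close>.\<close>

definition recursive :: "nat \<Rightarrow> (nat list \<Rightarrow> nat) \<Rightarrow> bool" where
  "recursive n F \<longleftrightarrow> (\<exists>r. \<forall>xs. length xs = n \<longrightarrow> evaluates r xs (F xs))"

named_theorems rec_intros

lemma recursive_cong:
  assumes "recursive n F" "\<And>xs. length xs = n \<Longrightarrow> F xs = F' xs"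
  shows "recursive n F'"
  using assms unfolding recursive_def by metis

lemma recursive_Compose:
  assumes F: "recursive (length Gs) F" and Gs: "\<forall>G\<in>set Gs. recursive n G"
  shows "recursive n (\<lambda>xs. F (map (\<lambda>G. G xs) Gs))"
proof -
  obtain r where r: "\<And>xs. length xs = length Gs \<Longrightarrow> evaluates r xs (F xs)"
    using F unfolding recursive_def by auto
  have "\<exists>rs. \<forall>xs. length xs = n \<longrightarrow> list_all2 (\<lambda>g y. evaluates g xs y) rs (map (\<lambda>G. G xs) Gs)"
    using Gs
  proof (induction Gs)
    case (Cons G Gs)
    then obtain rs s
      where "\<And>xs. length xs = n \<Longrightarrow> list_all2 (\<lambda>g y. evaluates g xs y) rs (map (\<lambda>G. G xs) Gs)"
        and "\<And>xs. length xs = n \<Longrightarrow> evaluates s xs (G xs)"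
      unfolding recursive_def by auto
    then show ?case by (intro exI[of _ "s # rs"]) simp
  qed simp
  then obtain rs
    where "\<And>xs. length xs = n \<Longrightarrow> list_all2 (\<lambda>g y. evaluates g xs y) rs (map (\<lambda>G. G xs) Gs)"
    by blast
  then have "evaluates (Compose r rs) xs (F (map (\<lambda>G. G xs) Gs))" if "length xs = n" for xs
    using that by (intro evaluates.compose[OF _ r]) auto
  then show ?thesis unfolding recursive_def by blast
qed

lemma recursive_compose1:
  assumes "recursive 1 (\<lambda>ys. F (hd ys))" "recursive n a"
  shows "recursive n (\<lambda>xs. F (a xs))"
  using recursive_Compose[of "[a]" "\<lambda>ys. F (hd ys)"] assms by simp

lemma recursive_compose2:
  assumes "recursive 2 (\<lambda>ys. F (hd ys) (hd (tl ys)))" "recursive n a" "recursive n b"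
  shows "recursive n (\<lambda>xs. F (a xs) (b xs))"
  using recursive_Compose[of "[a, b]" "\<lambda>ys. F (hd ys) (hd (tl ys))"] assms
  by (simp add: numeral_2_eq_2)

lemma recursive_nth:
  assumes "i < n"
  shows "recursive n (\<lambda>xs. xs ! i)"
  unfolding recursive_def using assms by (intro exI[of _ "Proj i"]) (auto intro: evaluates.proj)

lemma recursive_hd:
  assumes "i < n" "\<And>xs. length xs = n \<Longrightarrow> v xs = drop i xs"
  shows "recursive n (\<lambda>xs. hd (v xs))"
  by (rule recursive_cong[OF recursive_nth[OF assms(1)]])
     (simp add: assms hd_drop_conv_nth)

lemma recursive_variables [rec_intros]:
  "0 < n \<Longrightarrow> recursive n (\<lambda>xs. hd xs)"
  "1 < n \<Longrightarrow> recursive n (\<lambda>xs. hd (tl xs))"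
  "2 < n \<Longrightarrow> recursive n (\<lambda>xs. hd (tl (tl xs)))"
  "3 < n \<Longrightarrow> recursive n (\<lambda>xs. hd (tl (tl (tl xs))))"
  "4 < n \<Longrightarrow> recursive n (\<lambda>xs. hd (tl (tl (tl (tl xs)))))"
  "5 < n \<Longrightarrow> recursive n (\<lambda>xs. hd (tl (tl (tl (tl (tl xs))))))"
  "6 < n \<Longrightarrow> recursive n (\<lambda>xs. hd (tl (tl (tl (tl (tl (tl xs)))))))"
  by (erule recursive_hd, simp add: numeral_eq_Suc drop_Suc)+

lemma recursive_Suc [rec_intros]: "recursive n a \<Longrightarrow> recursive n (\<lambda>xs. Suc (a xs))"
proof (rule recursive_compose1[where F = Suc])
  have "evaluates Succ xs (Suc (hd xs))" if "length xs = 1" for xs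
    using that evaluates.succ by (auto simp: length_Suc_conv)
  then show "recursive 1 (\<lambda>ys. Suc (hd ys))" unfolding recursive_def by blast
qed

lemma recursive_const [rec_intros]: "recursive n (\<lambda>_. k)"
proof (induction k)
  case 0
  show ?case unfolding recursive_def by (blast intro: evaluates.zero)
qed (rule recursive_Suc)

text \<open>The program for primitive recursion receives the recursion argument in front of the list \<open>xs\<close>, so
it is composed with the program for \<open>b\<close> and with the projections that restore \<open>xs\<close>.\<close>

lemma recursive_rec_nat [rec_intros]:
  assumes g: "recursive n g"
    and h: "recursive (Suc (Suc n)) (\<lambda>ys. h (hd ys) (hd (tl ys)) (tl (tl ys)))"
    and b: "recursive n b"
  shows "recursive n (\<lambda>xs. rec_nat (g xs) (\<lambda>i y. h i y xs) (b xs))"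
proof -
  obtain rg where rg: "\<And>xs. length xs = n \<Longrightarrow> evaluates rg xs (g xs)"
    using g unfolding recursive_def by blast
  obtain rh where "\<And>ys. length ys = Suc (Suc n) \<Longrightarrow>
      evaluates rh ys (h (hd ys) (hd (tl ys)) (tl (tl ys)))"
    using h unfolding recursive_def by blast
  then have rh: "evaluates rh (i # y # xs) (h i y xs)" if "length xs = n" for i y xs
    using that by (metis length_Cons list.sel(1,3))
  have eval: "evaluates (Prim_rec rg rh) (k # xs) (rec_nat (g xs) (\<lambda>i y. h i y xs) k)"
    if "length xs = n" for k xs
    by (induction k) (auto intro: evaluates.intros rg rh that)
  let ?F = "\<lambda>ys. rec_nat (g (tl ys)) (\<lambda>i y. h i y (tl ys)) (hd ys)"
  have rec: "recursive (Suc n) ?F"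
    unfolding recursive_def
  proof (intro exI allI impI)
    fix ys :: "nat list"
    assume "length ys = Suc n"
    then show "evaluates (Prim_rec rg rh) ys (?F ys)"
      using eval[of "tl ys" "hd ys"] by (cases ys) auto
  qed
  let ?Gs = "b # map (\<lambda>i xs. xs ! i) [0..<n]"
  have "recursive n (\<lambda>xs. ?F (map (\<lambda>G. G xs) ?Gs))"
    by (rule recursive_Compose) (auto intro: b recursive_nth rec)
  moreover have "map (\<lambda>i. xs ! i) [0..<n] = xs" if "length xs = n" for xs :: "nat list"
    using that map_nth by blast
  ultimately show ?thesis
    by (elim recursive_cong) (simp add: o_def)
qed

lemma recursive_add [rec_intros]:
  assumes "recursive n a" "recursive n b"
  shows "recursive n (\<lambda>xs. a xs + b xs)"
proof (rule recursive_compose2[where F = "(+)", OF _ assms])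
  have "rec_nat x (\<lambda>_. Suc) y = x + y" for x y
    by (induction y) auto
  moreover have "recursive 2 (\<lambda>ys. rec_nat (hd ys) (\<lambda>_. Suc) (hd (tl ys)))"
    by (intro rec_intros) simp_all
  ultimately show "recursive 2 (\<lambda>ys. hd ys + hd (tl ys))" by simp
qed

lemma recursive_sum [rec_intros]:
  assumes F: "recursive (Suc n) (\<lambda>ys. F (hd ys) (tl ys))" and b: "recursive n b"
  shows "recursive n (\<lambda>xs. \<Sum>j<b xs. F j xs)"
proof -
  \<comment> \<open>the recursion step sees the partial sum at position 1, which the summand must skip\<close>
  let ?Gs = "hd # map (\<lambda>i ys. ys ! Suc (Suc i)) [0..<n]"
  have "recursive (Suc (Suc n)) (\<lambda>ys. (\<lambda>ys. F (hd ys) (tl ys)) (map (\<lambda>G. G ys) ?Gs))"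
    by (rule recursive_Compose) (auto intro: F recursive_nth rec_intros)
  moreover have "map (\<lambda>i. ys ! Suc (Suc i)) [0..<n] = tl (tl ys)"
    if "length ys = Suc (Suc n)" for ys :: "nat list"
    using that by (intro nth_equalityI) (auto simp: nth_tl)
  ultimately have F': "recursive (Suc (Suc n)) (\<lambda>ys. F (hd ys) (tl (tl ys)))"
    by (elim recursive_cong) (simp add: o_def)
  have "recursive n (\<lambda>xs. rec_nat 0 (\<lambda>j y. y + F j xs) (b xs))"
    by (intro rec_intros F' b) simp_all
  moreover have "rec_nat 0 (\<lambda>j y. y + F j xs) k = (\<Sum>j<k. F j xs)" for k xs
    by (induction k) auto
  ultimately show ?thesis by simp
qed

lemma recursive_mult [rec_intros]:
  assumes "recursive n a" "recursive n b"
  shows "recursive n (\<lambda>xs. a xs * b xs)"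
proof (rule recursive_compose2[where F = "(*)", OF _ assms])
  have "recursive 2 (\<lambda>ys. \<Sum>j<hd (tl ys). hd ys)"
    by (intro rec_intros) simp_all
  then show "recursive 2 (\<lambda>ys. hd ys * hd (tl ys))" by (simp add: mult.commute)
qed

lemma recursive_diff [rec_intros]:
  assumes "recursive n a" "recursive n b"
  shows "recursive n (\<lambda>xs. a xs - b xs)"
proof (rule recursive_compose2[where F = "(-)", OF _ assms])
  have pred: "recursive m (\<lambda>xs. c xs - 1)" if "recursive m c" for m c
  proof (rule recursive_compose1[where F = "\<lambda>x. x - 1", OF _ that])
    have "rec_nat 0 (\<lambda>i _. i) x = x - 1" for x
      by (cases x) auto
    moreover have "recursive 1 (\<lambda>ys. rec_nat 0 (\<lambda>i _. i) (hd ys))"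
      by (intro rec_intros) simp_all
    ultimately show "recursive 1 (\<lambda>ys. hd ys - 1)" by simp
  qed
  have "rec_nat x (\<lambda>_ z. z - 1) y = x - y" for x y :: nat
    by (induction y) auto
  moreover have "recursive 2 (\<lambda>ys. rec_nat (hd ys) (\<lambda>_ z. z - 1) (hd (tl ys)))"
    by (intro rec_intros pred) simp_all
  ultimately show "recursive 2 (\<lambda>ys. hd ys - hd (tl ys))" by simp
qed

lemma recursive_power [rec_intros]:
  assumes "recursive n a" "recursive n b"
  shows "recursive n (\<lambda>xs. a xs ^ b xs)"
proof (rule recursive_compose2[where F = "(^)", OF _ assms])
  have "rec_nat 1 (\<lambda>_ z. x * z) y = x ^ y" for x y :: nat
    by (induction y) auto
  moreover have "recursive 2 (\<lambda>ys. rec_nat 1 (\<lambda>_ z. hd ys * z) (hd (tl ys)))"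
  proof -
    have 1: "recursive 4 (\<lambda>ys. hd (tl (tl ys)) * hd (tl ys))"
      by (intro rec_intros) simp_all
    show ?thesis
      by (intro rec_intros) (use 1 in \<open>simp_all add: numeral_eq_Suc\<close>)
  qed
  ultimately show "recursive 2 (\<lambda>ys. hd ys ^ hd (tl ys))" by simp
qed

definition decidable :: "nat \<Rightarrow> (nat list \<Rightarrow> bool) \<Rightarrow> bool" where
  "decidable n P \<longleftrightarrow> recursive n (\<lambda>xs. of_bool (P xs))"

lemma recursive_if [rec_intros]:
  assumes "decidable n P" "recursive n a" "recursive n b"
  shows "recursive n (\<lambda>xs. if P xs then a xs else b xs)"
proof -
  have "recursive n (\<lambda>xs. of_bool (P xs) * a xs + (1 - of_bool (P xs)) * b xs)"
    using assms unfolding decidable_def by (intro rec_intros)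
  then show ?thesis by (rule recursive_cong) simp
qed

lemma decidable_le [rec_intros]:
  assumes "recursive n a" "recursive n b"
  shows "decidable n (\<lambda>xs. a xs \<le> b xs)"
proof -
  have "recursive n (\<lambda>xs. 1 - (a xs - b xs))"
    by (intro rec_intros assms)
  then show ?thesis
    unfolding decidable_def by (rule recursive_cong) (simp add: of_bool_def)
qed

lemma decidable_not [rec_intros]: "decidable n P \<Longrightarrow> decidable n (\<lambda>xs. \<not> P xs)"
proof -
  assume "decidable n P"
  then have "recursive n (\<lambda>xs. 1 - of_bool (P xs))"
    unfolding decidable_def by (intro rec_intros)
  then show ?thesis
    unfolding decidable_def by (rule recursive_cong) simp
qed

lemma decidable_conj [rec_intros]:
  assumes "decidable n P" "decidable n Q"
  shows "decidable n (\<lambda>xs. P xs \<and> Q xs)"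
proof -
  have "recursive n (\<lambda>xs. of_bool (P xs) * of_bool (Q xs))"
    using assms unfolding decidable_def by (intro rec_intros)
  then show ?thesis
    unfolding decidable_def by (rule recursive_cong) simp
qed

lemma decidable_eq [rec_intros]:
  assumes "recursive n a" "recursive n b"
  shows "decidable n (\<lambda>xs. a xs = b xs)"
proof -
  have "decidable n (\<lambda>xs. a xs \<le> b xs \<and> b xs \<le> a xs)"
    by (intro rec_intros assms)
  then show ?thesis unfolding eq_iff[symmetric] .
qed

text \<open>The quotient counts the positive multiples of \<open>d\<close> up to \<open>x\<close>, which makes it a bounded sum.\<close>

lemma nat_div_eq_sum: "d > 0 \<Longrightarrow> x div d = (\<Sum>i<x. of_bool (Suc i * d \<le> x))" for x d :: nat
proof -
  assume d: "d > 0"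
  have "{..<x} \<inter> {i. Suc i * d \<le> x} = {..<x div d}"
  proof (intro set_eqI iffI)
    fix i assume "i \<in> {..<x} \<inter> {i. Suc i * d \<le> x}"
    then show "i \<in> {..<x div d}"
      using d by (simp add: less_eq_div_iff_mult_less_eq Suc_le_eq[symmetric] del: mult_Suc)
  next
    fix i assume i: "i \<in> {..<x div d}"
    then have "Suc i * d \<le> x"
      using d by (simp add: less_eq_div_iff_mult_less_eq Suc_le_eq[symmetric] del: mult_Suc)
    moreover have "i < x" using i div_le_dividend[of x d] by (simp del: div_le_dividend)
    ultimately show "i \<in> {..<x} \<inter> {i. Suc i * d \<le> x}" by simp
  qed
  then show ?thesis
    by (simp add: of_bool_def sum.If_cases del: mult_Suc)
qed

lemma recursive_div [rec_intros]:
  assumes "recursive n a" "recursive n b"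
  shows "recursive n (\<lambda>xs. a xs div b xs)"
proof (rule recursive_compose2[where F = "(div)", OF _ assms])
  have "recursive 2 (\<lambda>ys. if hd (tl ys) = 0 then 0
      else \<Sum>i<hd ys. if Suc i * hd (tl ys) \<le> hd ys then 1 else 0)"
    by (intro rec_intros) simp_all
  then show "recursive 2 (\<lambda>ys. hd ys div hd (tl ys))"
    by (rule recursive_cong) (simp add: nat_div_eq_sum of_bool_def)
qed

lemma decidable_even [rec_intros]:
  assumes "recursive n a"
  shows "decidable n (\<lambda>xs. even (a xs))"
proof -
  have "decidable n (\<lambda>xs. 2 * (a xs div 2) = a xs)"
    by (intro rec_intros assms)
  moreover have "2 * (x div 2) = x \<longleftrightarrow> even x" for x :: nat
    by presburger
  ultimately show ?thesis by simp
qed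

lemma decidable_mem_set_decode [rec_intros]:
  assumes "recursive n a" "recursive n b"
  shows "decidable n (\<lambda>xs. a xs \<in> set_decode (b xs))"
  unfolding set_decode_def mem_Collect_eq by (intro rec_intros assms)

lemma recursive_prod_encode [rec_intros]:
  assumes "recursive n a" "recursive n b"
  shows "recursive n (\<lambda>xs. prod_encode (a xs, b xs))"
  unfolding prod_encode_def triangle_def prod.case by (intro rec_intros assms)

text \<open>The components of a pair are at most its code, so decoding is a bounded search; the search is a
double sum with a single nonzero summand.\<close>

lemma sum_prod_encode_eq:
  fixes g :: "nat \<Rightarrow> nat \<Rightarrow> 'a::comm_monoid_add"
  shows "(\<Sum>a<Suc z. \<Sum>b<Suc z. if prod_encode (a, b) = z then g a b else 0) =
    g (fst (prod_decode z)) (snd (prod_decode z))"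
proof -
  have iff: "prod_encode p = z \<longleftrightarrow> p = prod_decode z" for p
    by (metis prod_decode_inverse prod_encode_inverse)
  have mem: "prod_decode z \<in> {..<Suc z} \<times> {..<Suc z}"
    using le_prod_encode_1[of "fst (prod_decode z)" "snd (prod_decode z)"]
      le_prod_encode_2[of "snd (prod_decode z)" "fst (prod_decode z)"]
    by (simp add: mem_Times_iff less_Suc_eq_le)
  have "(\<Sum>a<Suc z. \<Sum>b<Suc z. if prod_encode (a, b) = z then g a b else 0) =
      (\<Sum>p\<in>{..<Suc z} \<times> {..<Suc z}. if p = prod_decode z then case_prod g p else 0)"
    unfolding sum.cartesian_product by (intro sum.cong) (auto simp flip: iff)
  also have "\<dots> = case_prod g (prod_decode z)"
    using mem by (subst sum.delta) auto
  finally show ?thesis by (simp add: case_prod_beta)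
qed

lemma recursive_fst_prod_decode [rec_intros]:
  assumes "recursive n a"
  shows "recursive n (\<lambda>xs. fst (prod_decode (a xs)))"
proof (rule recursive_compose1[where F = "\<lambda>x. fst (prod_decode x)", OF _ assms])
  have "recursive 1 (\<lambda>ys. \<Sum>a<Suc (hd ys). \<Sum>b<Suc (hd ys).
      if prod_encode (a, b) = hd ys then a else 0)"
    by (intro rec_intros) simp_all
  then show "recursive 1 (\<lambda>ys. fst (prod_decode (hd ys)))"
    unfolding sum_prod_encode_eq .
qed

lemma recursive_snd_prod_decode [rec_intros]:
  assumes "recursive n a"
  shows "recursive n (\<lambda>xs. snd (prod_decode (a xs)))"
proof (rule recursive_compose1[where F = "\<lambda>x. snd (prod_decode x)", OF _ assms])
  have "recursive 1 (\<lambda>ys. \<Sum>a<Suc (hd ys). \<Sum>b<Suc (hd ys).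
      if prod_encode (a, b) = hd ys then b else 0)"
    by (intro rec_intros) simp_all
  then show "recursive 1 (\<lambda>ys. snd (prod_decode (hd ys)))"
    unfolding sum_prod_encode_eq .
qed

text \<open>Recursiveness of an integer-valued function, as a difference of two recursive functions: in this form
it passes to sums and products without case distinctions on signs.\<close>

definition int_recursive :: "nat \<Rightarrow> (nat list \<Rightarrow> int) \<Rightarrow> bool" where
  "int_recursive n F \<longleftrightarrow>
     (\<exists>a b. recursive n a \<and> recursive n b \<and> (\<forall>xs. F xs = int (a xs) - int (b xs)))"

lemma int_recursiveI:
  "recursive n a \<Longrightarrow> recursive n b \<Longrightarrow> (\<And>xs. F xs = int (a xs) - int (b xs)) \<Longrightarrow> int_recursive n F"
  unfolding int_recursive_def by blast

lemma int_recursive_int [rec_intros]: "recursive n a \<Longrightarrow> int_recursive n (\<lambda>xs. int (a xs))"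
  by (rule int_recursiveI[where b = "\<lambda>_. 0"]) (auto intro: rec_intros)

lemma int_recursive_const [rec_intros]: "int_recursive n (\<lambda>_. c)"
  by (rule int_recursiveI[where a = "\<lambda>_. nat c" and b = "\<lambda>_. nat (- c)"])
     (auto intro: rec_intros)

lemma int_recursive_mult [rec_intros]:
  assumes "int_recursive n F" "int_recursive n H"
  shows "int_recursive n (\<lambda>xs. F xs * H xs)"
proof -
  obtain a b where ab: "recursive n a" "recursive n b" and F: "\<And>xs. F xs = int (a xs) - int (b xs)"
    using assms(1) unfolding int_recursive_def by blast
  obtain c d where cd: "recursive n c" "recursive n d" and H: "\<And>xs. H xs = int (c xs) - int (d xs)"
    using assms(2) unfolding int_recursive_def by blast
  show ?thesis
  proof (rule int_recursiveI)
    show "recursive n (\<lambda>xs. a xs * c xs + b xs * d xs)" "recursive n (\<lambda>xs. a xs * d xs + b xs * c xs)"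
      by (intro rec_intros ab cd)+
  qed (simp add: F H algebra_simps)
qed

lemma int_recursive_if [rec_intros]:
  assumes "decidable n P" "int_recursive n F" "int_recursive n H"
  shows "int_recursive n (\<lambda>xs. if P xs then F xs else H xs)"
proof -
  obtain a b where ab: "recursive n a" "recursive n b" and F: "\<And>xs. F xs = int (a xs) - int (b xs)"
    using assms(2) unfolding int_recursive_def by blast
  obtain c d where cd: "recursive n c" "recursive n d" and H: "\<And>xs. H xs = int (c xs) - int (d xs)"
    using assms(3) unfolding int_recursive_def by blast
  show ?thesis
  proof (rule int_recursiveI)
    show "recursive n (\<lambda>xs. if P xs then a xs else c xs)" "recursive n (\<lambda>xs. if P xs then b xs else d xs)"
      by (intro rec_intros ab cd assms)+
  qed (simp add: F H)
qed

lemma int_recursive_sum [rec_intros]: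
  assumes F: "int_recursive (Suc n) (\<lambda>ys. F (hd ys) (tl ys))" and b: "recursive n b"
  shows "int_recursive n (\<lambda>xs. \<Sum>j<b xs. F j xs)"
proof -
  obtain c d where cd: "recursive (Suc n) c" "recursive (Suc n) d"
    and F: "\<And>ys. F (hd ys) (tl ys) = int (c ys) - int (d ys)"
    using F unfolding int_recursive_def by blast
  have cd': "recursive (Suc n) (\<lambda>ys. c (hd ys # tl ys))" "recursive (Suc n) (\<lambda>ys. d (hd ys # tl ys))"
    by (rule recursive_cong[OF cd(1)] recursive_cong[OF cd(2)]; auto simp: length_Suc_conv)+
  show ?thesis
  proof (rule int_recursiveI)
    show "recursive n (\<lambda>xs. \<Sum>j<b xs. c (j # xs))" "recursive n (\<lambda>xs. \<Sum>j<b xs. d (j # xs))"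
      by (rule recursive_sum[OF _ b], rule cd')+
    show "(\<Sum>j<b xs. F j xs) = int (\<Sum>j<b xs. c (j # xs)) - int (\<Sum>j<b xs. d (j # xs))" for xs
      using F[of "_ # xs"] by (simp add: sum_subtractf)
  qed
qed

lemma int_recursive_power_minus_one [rec_intros]:
  assumes "recursive n a"
  shows "int_recursive n (\<lambda>xs. (- 1) ^ a xs)"
proof -
  have "int_recursive n (\<lambda>xs. if even (a xs) then 1 else - 1)"
    by (intro rec_intros assms)
  then show ?thesis by (simp add: minus_one_power_iff)
qed

lemma int_recursive_int_decode [rec_intros]:
  assumes "recursive n a"
  shows "int_recursive n (\<lambda>xs. int_decode (a xs))"
proof (rule int_recursiveI)
  show "recursive n (\<lambda>xs. if even (a xs) then a xs div 2 else 0)"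
    "recursive n (\<lambda>xs. if even (a xs) then 0 else Suc (a xs div 2))"
    by (intro rec_intros assms)+
qed (simp add: int_decode_def sum_decode_def)

lemma recursive_int_encode [rec_intros]:
  assumes "int_recursive n F"
  shows "recursive n (\<lambda>xs. int_encode (F xs))"
proof -
  obtain a b where ab: "recursive n a" "recursive n b" and F: "\<And>xs. F xs = int (a xs) - int (b xs)"
    using assms unfolding int_recursive_def by blast
  have "recursive n (\<lambda>xs. if b xs \<le> a xs then 2 * (a xs - b xs) else 2 * (b xs - a xs) - 1)"
    by (intro rec_intros ab)
  then show ?thesis
    by (rule recursive_cong) (auto simp: F int_encode_def sum_encode_def)
qed

lemma decidable_int_eq [rec_intros]:
  assumes "int_recursive n F" "int_recursive n H"
  shows "decidable n (\<lambda>xs. F xs = H xs)"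
proof -
  have "decidable n (\<lambda>xs. int_encode (F xs) = int_encode (H xs))"
    by (intro rec_intros assms)
  then show ?thesis by (simp add: int_encode_eq)
qed

section \<open>Computing the sign product on codes\<close>

lemma mem_less_set_encode: "finite A \<Longrightarrow> x \<in> A \<Longrightarrow> x < set_encode A"
proof -
  assume A: "finite A" "x \<in> A"
  have "x < 2 ^ x" by (rule less_exp)
  also have "\<dots> \<le> set_encode A"
    unfolding set_encode_def using A by (intro member_le_sum) auto
  finally show ?thesis .
qed

text \<open>Both kinds of codes are sets of pairs of a key and a value.  A sum over the entries of the coded map
is a sum over all pairs of numbers below the code, restricted to those whose bit is set, because a
number is smaller than the code of any finite set that contains it.\<close>

lemma sum_over_graph_code:
  fixes g :: "nat \<Rightarrow> nat \<Rightarrow> 'a::comm_monoid_add"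
  assumes "finite K" "inj_on c K" and z: "z = set_encode ((\<lambda>k. prod_encode (c k, d k)) ` K)"
  shows "(\<Sum>a<z. \<Sum>b<z. if prod_encode (a, b) \<in> set_decode z then g a b else 0) =
    (\<Sum>k\<in>K. g (c k) (d k))"
proof -
  have dec: "set_decode z = (\<lambda>k. prod_encode (c k, d k)) ` K"
    unfolding z using assms(1) by simp
  have less: "prod_encode (c k, d k) < z" if "k \<in> K" for k
    unfolding z using assms(1) that by (intro mem_less_set_encode) auto
  have sub: "(\<lambda>k. (c k, d k)) ` K \<subseteq> {..<z} \<times> {..<z}"
    using le_less_trans[OF le_prod_encode_1 less] le_less_trans[OF le_prod_encode_2 less] by auto
  have "(\<Sum>a<z. \<Sum>b<z. if prod_encode (a, b) \<in> set_decode z then g a b else 0) =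
      (\<Sum>p\<in>{..<z} \<times> {..<z}. if p \<in> (\<lambda>k. (c k, d k)) ` K then case_prod g p else 0)"
    unfolding sum.cartesian_product dec by (intro sum.cong refl) (auto simp: image_iff)
  also have "\<dots> = (\<Sum>p\<in>(\<lambda>k. (c k, d k)) ` K. case_prod g p)"
    using sub by (subst sum.inter_restrict[symmetric]) (auto simp: Int_absorb1)
  also have "\<dots> = (\<Sum>k\<in>K. g (c k) (d k))"
    using assms(2) by (subst sum.reindex) (auto simp: inj_on_def)
  finally show ?thesis .
qed

definition exponent :: "nat \<Rightarrow> nat \<Rightarrow> nat" where
  "exponent m i = (\<Sum>j<m. \<Sum>e<m. if prod_encode (j, e) \<in> set_decode m then (if j = i then e else 0) else 0)"

text \<open>The code of the product of the monomials coded by \<open>a\<close> and \<open>b\<close>.  An unknown that occurs in one of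
them has an index below the code of that monomial, hence below \<open>a + b\<close>.\<close>

definition monom_times :: "nat \<Rightarrow> nat \<Rightarrow> nat" where
  "monom_times a b = (\<Sum>i<a + b. if exponent a i + exponent b i = 0 then 0
     else 2 ^ prod_encode (i, exponent a i + exponent b i))"

text \<open>For the code \<open>c\<close> of a polynomial \<open>C\<close>, the coefficient of the monomial coded by \<open>m\<close> in
\<open>C * flip k C\<close>; it is \<open>0\<close> if \<open>m\<close> does not code a monomial.\<close>

definition product_coeff :: "nat \<Rightarrow> nat \<Rightarrow> nat \<Rightarrow> int" where
  "product_coeff k c m =
     (\<Sum>a<c. \<Sum>u<c. if prod_encode (a, u) \<in> set_decode c then
        (\<Sum>b<c. \<Sum>v<c. if prod_encode (b, v) \<in> set_decode c then
           (if monom_times a b = m then int_decode u * ((- 1) ^ exponent b k * int_decode v) else 0)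
         else 0) else 0)"

text \<open>The code of \<open>C * flip k C\<close> from the code \<open>c\<close> of \<open>C\<close>.  Every monomial of the product
is a product of two monomials of \<open>C\<close>, so its code is among the summands \<open>monom_times a b\<close>,
whose total therefore bounds the range of \<open>m\<close>.\<close>

definition times_flip_code :: "nat \<Rightarrow> nat \<Rightarrow> nat" where
  "times_flip_code k c =
     (\<Sum>m<Suc (\<Sum>a<c. \<Sum>b<c. monom_times a b). if product_coeff k c m = 0 then 0
        else 2 ^ prod_encode (m, int_encode (product_coeff k c m)))"

lemma key_less_code_monom: "i \<in> keys t \<Longrightarrow> i < code_monom t"
proof -
  assume i: "i \<in> keys t"
  have "i \<le> prod_encode (i, lookup t i)" by (rule le_prod_encode_1)
  also have "\<dots> < code_monom t"
    unfolding code_monom_def using i by (intro mem_less_set_encode) auto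
  finally show ?thesis .
qed

lemma code_monom_less_code_mpoly: "t \<in> keys C \<Longrightarrow> code_monom t < code_mpoly C"
proof -
  assume t: "t \<in> keys C"
  have "code_monom t \<le> prod_encode (code_monom t, int_encode (lookup C t))" by (rule le_prod_encode_1)
  also have "\<dots> < code_mpoly C"
    unfolding code_mpoly_def using t by (intro mem_less_set_encode) auto
  finally show ?thesis .
qed

lemma inj_code_monom: "inj code_monom"
  by (rule injI, unfold code_monom_def, rule graph_code_inj[where c = id and d = id]) simp_all

lemma exponent_code_monom: "exponent (code_monom t) i = lookup t i"
proof -
  have "exponent (code_monom t) i = (\<Sum>j\<in>keys t. if j = i then lookup t j else 0)"
    unfolding exponent_def by (rule sum_over_graph_code) (auto simp: code_monom_def)
  then show ?thesis by (simp add: in_keys_iff)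
qed

text \<open>Set codes are sums of powers of two, so the code of a graph is a bounded sum as soon as a bound for
the keys is known.\<close>

lemma sum_bounded_eq_set_encode:
  assumes "K \<subseteq> {..<N}"
  shows "(\<Sum>k<N. if k \<in> K then 2 ^ prod_encode (k, d k) else 0) =
    set_encode ((\<lambda>k. prod_encode (k, d k)) ` K)"
proof -
  have "set_encode ((\<lambda>k. prod_encode (k, d k)) ` K) = (\<Sum>k\<in>K. 2 ^ prod_encode (k, d k))"
    unfolding set_encode_def by (subst sum.reindex) (auto simp: inj_on_def)
  also have "\<dots> = (\<Sum>k<N. if k \<in> K then 2 ^ prod_encode (k, d k) else 0)"
    using assms by (subst sum.inter_restrict[symmetric]) (auto simp: Int_absorb1)
  finally show ?thesis ..
qed

lemma monom_times_code: "monom_times (code_monom s) (code_monom t) = code_monom (s + t)"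
proof -
  have "keys (s + t) \<subseteq> {..<code_monom s + code_monom t}"
  proof
    fix i assume "i \<in> keys (s + t)"
    then have "i \<in> keys s \<or> i \<in> keys t" using keys_add[of s t] by blast
    then show "i \<in> {..<code_monom s + code_monom t}" by (auto dest: key_less_code_monom)
  qed
  from sum_bounded_eq_set_encode[OF this, of "lookup (s + t)"] show ?thesis
    unfolding monom_times_def exponent_code_monom code_monom_def[of "s + t"]
    by (elim trans[rotated], intro sum.cong) (auto simp: in_keys_iff lookup_add)
qed

lemma product_coeff_code:
  "product_coeff k (code_mpoly C) m =
     (\<Sum>a\<in>keys C. \<Sum>b\<in>keys C. if code_monom (a + b) = m
        then lookup C a * ((- 1) ^ lookup b k * lookup C b) else 0)"
proof -
  let ?c = "code_mpoly C"
  have "(\<Sum>a<?c. \<Sum>u<?c. if prod_encode (a, u) \<in> set_decode ?c then g a u else 0) =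
      (\<Sum>t\<in>keys C. g (code_monom t) (int_encode (lookup C t)))" for g :: "nat \<Rightarrow> nat \<Rightarrow> int"
    by (rule sum_over_graph_code[OF finite_keys inj_on_subset[OF inj_code_monom subset_UNIV]])
       (rule code_mpoly_def)
  then show ?thesis
    unfolding product_coeff_def by (simp only: monom_times_code exponent_code_monom int_encode_inverse)
qed

lemma times_flip_code_mpoly: "times_flip_code k (code_mpoly C) = code_mpoly (C * flip k C)"
proof -
  let ?P = "C * flip k C" and ?c = "code_mpoly C"
  have coeff: "product_coeff k ?c (code_monom t) = lookup ?P t" for t
    unfolding product_coeff_code lookup_times_flip
    by (simp add: inj_eq[OF inj_code_monom])
  have sub: "\<exists>a\<in>keys C. \<exists>b\<in>keys C. code_monom (a + b) = m" if "product_coeff k ?c m \<noteq> 0" for m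
  proof (rule ccontr)
    assume "\<not> ?thesis"
    then have "product_coeff k ?c m = 0"
      unfolding product_coeff_code by (intro sum.neutral ballI) auto
    with that show False by contradiction
  qed
  have K: "{m. product_coeff k ?c m \<noteq> 0} = code_monom ` keys ?P"
  proof (intro set_eqI iffI)
    fix m assume m: "m \<in> {m. product_coeff k ?c m \<noteq> 0}"
    then obtain t where "m = code_monom t" using sub by blast
    with m show "m \<in> code_monom ` keys ?P" by (simp add: coeff in_keys_iff)
  qed (auto simp: coeff in_keys_iff)
  define N where "N = Suc (\<Sum>a<?c. \<Sum>b<?c. monom_times a b)"
  have "m < N" if nz: "product_coeff k ?c m \<noteq> 0" for m
  proof -
    obtain a b where ab: "a \<in> keys C" "b \<in> keys C" "m = code_monom (a + b)"
      using sub[OF nz] by auto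
    have less: "code_monom a \<in> {..<?c}" "code_monom b \<in> {..<?c}"
      using ab code_monom_less_code_mpoly by auto
    have "m = monom_times (code_monom a) (code_monom b)"
      by (simp add: ab monom_times_code)
    also have "\<dots> \<le> (\<Sum>b<?c. monom_times (code_monom a) b)"
      using less by (intro member_le_sum) auto
    also have "\<dots> \<le> (\<Sum>a<?c. \<Sum>b<?c. monom_times a b)"
      using less by (intro member_le_sum[of _ _ "\<lambda>a. \<Sum>b<?c. monom_times a b"]) auto
    finally show ?thesis unfolding N_def by (rule le_imp_less_Suc)
  qed
  then have "{m. product_coeff k ?c m \<noteq> 0} \<subseteq> {..<N}" by blast
  from sum_bounded_eq_set_encode[OF this, of "\<lambda>m. int_encode (product_coeff k ?c m)"]
  have "times_flip_code k ?c =
      set_encode ((\<lambda>m. prod_encode (m, int_encode (product_coeff k ?c m))) ` {m. product_coeff k ?c m \<noteq> 0})"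
    unfolding times_flip_code_def N_def[symmetric] by (elim trans[rotated], intro sum.cong) auto
  also have "\<dots> = code_mpoly ?P"
    unfolding K image_image coeff code_mpoly_def[of ?P] ..
  finally show ?thesis .
qed

lemma recursive_exponent [rec_intros]:
  assumes "recursive n a" "recursive n b"
  shows "recursive n (\<lambda>xs. exponent (a xs) (b xs))"
proof (rule recursive_compose2[where F = exponent, OF _ assms])
  show "recursive 2 (\<lambda>ys. exponent (hd ys) (hd (tl ys)))"
    unfolding exponent_def by (intro rec_intros) simp_all
qed

lemma recursive_monom_times [rec_intros]:
  assumes "recursive n a" "recursive n b"
  shows "recursive n (\<lambda>xs. monom_times (a xs) (b xs))"
proof (rule recursive_compose2[where F = monom_times, OF _ assms])
  show "recursive 2 (\<lambda>ys. monom_times (hd ys) (hd (tl ys)))"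
    unfolding monom_times_def by (intro rec_intros) simp_all
qed

lemma int_recursive_product_coeff:
  "int_recursive 3 (\<lambda>ys. product_coeff (hd (tl ys)) (hd (tl (tl ys))) (hd ys))"
  unfolding product_coeff_def by (intro rec_intros) simp_all

lemma recursive_times_flip_code [rec_intros]:
  assumes "recursive n a" "recursive n b"
  shows "recursive n (\<lambda>xs. times_flip_code (a xs) (b xs))"
proof (rule recursive_compose2[where F = times_flip_code, OF _ assms])
  have "int_recursive (Suc 2) (\<lambda>ys. product_coeff (hd (tl ys)) (hd (tl (tl ys))) (hd ys))"
    using int_recursive_product_coeff by (simp add: numeral_eq_Suc)
  then show "recursive 2 (\<lambda>ys. times_flip_code (hd ys) (hd (tl ys)))"
    unfolding times_flip_code_def by (intro rec_intros; assumption?) simp_all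
qed

text \<open>Step \<open>k\<close> of the recursion negates the unknown \<open>k + 1\<close>, as the recursion counts from \<open>0\<close> and the
unknowns from \<open>1\<close>.\<close>

lemma recursive_sign_product_code:
  "\<exists>F. recursive 1 F \<and> (\<forall>E. diophantine E \<longrightarrow> F [code_equation E] = code_equation (sign_product E))"
proof (intro exI conjI allI impI)
  let ?F = "\<lambda>xs. prod_encode (fst (prod_decode (hd xs)),
      rec_nat (snd (prod_decode (hd xs))) (\<lambda>k c. times_flip_code (Suc k) c) (fst (prod_decode (hd xs))))"
  show "recursive 1 ?F"
    by (intro rec_intros) simp_all
  fix E assume E: "diophantine E"
  have "rec_nat (code_mpoly (snd E)) (\<lambda>k c. times_flip_code (Suc k) c) n =
      code_mpoly (partial_sign_product n (snd E))" for n
    by (induction n) (simp_all add: partial_sign_product_0 partial_sign_product_Suc times_flip_code_mpoly)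
  then show "?F [code_equation E] = code_equation (sign_product E)"
    using sign_product_eq_partial[OF E]
    by (simp add: code_equation_def) (simp add: sign_product_def)
qed

lemma computable_sign_product:
  assumes "computable A"
  shows "computable (\<lambda>E. A (sign_product E))"
proof -
  obtain r where r: "\<And>E. diophantine E \<Longrightarrow> evaluates r [code_equation E] (int_encode (A E))"
    using assms unfolding computable_def by blast
  obtain F where F: "recursive 1 F"
    "\<And>E. diophantine E \<Longrightarrow> F [code_equation E] = code_equation (sign_product E)"
    using recursive_sign_product_code by blast
  obtain q where q: "\<And>xs. length xs = 1 \<Longrightarrow> evaluates q xs (F xs)"
    using F(1) unfolding recursive_def by blast
  have "evaluates (Compose r [q]) [code_equation E] (int_encode (A (sign_product E)))"
    if "diophantine E" for E
    using q[of "[code_equation E]"] r[OF diophantine_sign_product[OF that]] that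
    by (intro evaluates.compose[where ys = "[code_equation (sign_product E)]"]) (simp_all add: F)
  then show ?thesis unfolding computable_def by blast
qed

lemma integer_bounding_algorithm_sign_product:
  assumes A: "nonneg_bounding_algorithm A"
  shows "integer_bounding_algorithm (\<lambda>E. A (sign_product E))"
  unfolding integer_bounding_algorithm_def
proof (intro conjI allI impI ballI)
  show "computable (\<lambda>E. A (sign_product E))"
    using A by (intro computable_sign_product) (simp add: nonneg_bounding_algorithm_def)
  fix E y i
  assume E: "diophantine E" and fin: "finite (solutions UNIV E)"
    and y: "y \<in> solutions UNIV E" and i: "i \<in> {1..fst E}"
  let ?x = "\<lambda>i\<in>{1..fst E}. \<bar>y i\<bar>"
  have "finite (solutions \<nat> (sign_product E))" "?x \<in> solutions \<nat> (sign_product E)"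
    using fin y by (auto simp: solutions_sign_product[OF E])
  moreover have "i \<in> {1..fst (sign_product E)}" using i by (simp add: sign_product_def)
  ultimately have "?x i \<le> A (sign_product E)"
    using A diophantine_sign_product[OF E] unfolding nonneg_bounding_algorithm_def by blast
  with i show "\<bar>y i\<bar> \<le> A (sign_product E)" by simp
qed

section \<open>Systems of equations with arbitrary unknowns\<close>

text \<open>Systems of product and successor equations whose unknowns are the elements of an arbitrary set \<open>T\<close>:
\<open>R\<close> lists the equations \<open>a \<cdot> b = c\<close> and \<open>Q\<close> the equations \<open>a + 1 = b\<close>.\<close>

definition named_solutions :: "'a set \<Rightarrow> ('a \<times> 'a \<times> 'a) set \<Rightarrow> ('a \<times> 'a) set \<Rightarrow> ('a \<Rightarrow> nat) set" where
  "named_solutions T R Q = {v \<in> T \<rightarrow>\<^sub>E UNIV.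
     (\<forall>(a, b, c)\<in>R. v a * v b = v c) \<and> (\<forall>(a, b)\<in>Q. v a + 1 = v b)}"

text \<open>Numbering the unknowns by \<open>1, \<dots>, n\<close> for \<open>n = card T\<close> identifies such a system with a subset of
\<open>G n\<close>, and their sets of solutions with each other.  So only the number of unknowns matters.\<close>

lemma conjecture_A_named:
  assumes conj: conjecture_A
    and T: "finite T" "T \<noteq> {}" and R: "R \<subseteq> T \<times> T \<times> T" and Q: "Q \<subseteq> T \<times> T"
    and fin: "finite (named_solutions T R Q)"
    and v: "v \<in> named_solutions T R Q" and t: "t \<in> T"
  shows "v t \<le> f (2 * card T)"
proof -
  let ?n = "card T"
  obtain h where h: "bij_betw h {1..?n} T"
    using ex_bij_betw_nat_finite_1[OF T(1)] by blast
  define ix where "ix = inv_into {1..?n} h"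
  have ix: "ix a \<in> {1..?n}" "h (ix a) = a" if "a \<in> T" for a
    using bij_betw_inv_into_right[OF h that] bij_betwE[OF bij_betw_inv_into[OF h]] that
    by (auto simp: ix_def)
  have hx: "h k \<in> T" "ix (h k) = k" if "k \<in> {1..?n}" for k
    using bij_betwE[OF h] bij_betw_inv_into_left[OF h that] that by (auto simp: ix_def)
  define S where "S = (\<lambda>(a, b, c). Mult_eq (ix a) (ix b) (ix c)) ` R \<union> (\<lambda>(a, b). Succ_eq (ix a) (ix b)) ` Q"
  have sub: "S \<subseteq> G ?n"
  proof
    fix e assume "e \<in> S"
    then show "e \<in> G ?n"
      unfolding S_def
    proof (elim UnE imageE)
      fix r assume r: "e = (case r of (a, b, c) \<Rightarrow> Mult_eq (ix a) (ix b) (ix c))" "r \<in> R"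
      then obtain a b c where "r = (a, b, c)" "a \<in> T" "b \<in> T" "c \<in> T" using R by blast
      with r(1) ix(1) show ?thesis unfolding G_def by simp
    next
      fix r assume r: "e = (case r of (a, b) \<Rightarrow> Succ_eq (ix a) (ix b))" "r \<in> Q"
      then obtain a b where "r = (a, b)" "a \<in> T" "b \<in> T" using Q by blast
      with r(1) ix(1) show ?thesis unfolding G_def by simp
    qed
  qed
  define pull where "pull x = (\<lambda>a\<in>T. x (ix a))" for x :: "nat \<Rightarrow> nat"
  have pull: "pull x \<in> named_solutions T R Q" if "x \<in> system_solutions ?n S" for x
  proof -
    have sat: "satisfies x e" if "e \<in> S" for e
      using that \<open>x \<in> system_solutions ?n S\<close> by (simp add: system_solutions_def)
    have "pull x a * pull x b = pull x c" if abc: "(a, b, c) \<in> R" for a b c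
      using sat[of "Mult_eq (ix a) (ix b) (ix c)"] R abc by (force simp: S_def pull_def)
    moreover have "pull x a + 1 = pull x b" if ab: "(a, b) \<in> Q" for a b
      using sat[of "Succ_eq (ix a) (ix b)"] Q ab by (force simp: S_def pull_def)
    moreover have "pull x \<in> T \<rightarrow>\<^sub>E UNIV" by (simp add: pull_def)
    ultimately show ?thesis unfolding named_solutions_def by blast
  qed
  have "inj_on pull (system_solutions ?n S)"
  proof (rule inj_onI)
    fix x y assume xy: "x \<in> system_solutions ?n S" "y \<in> system_solutions ?n S" and eq: "pull x = pull y"
    show "x = y"
    proof (rule PiE_ext)
      show "x \<in> {1..?n} \<rightarrow>\<^sub>E UNIV" "y \<in> {1..?n} \<rightarrow>\<^sub>E UNIV"
        using xy by (auto simp: system_solutions_def)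
      show "x k = y k" if "k \<in> {1..?n}" for k
        using fun_cong[OF eq, of "h k"] hx[OF that] by (simp add: pull_def)
    qed
  qed
  then have finS: "finite (system_solutions ?n S)"
    using pull by (intro finite_imageD[OF finite_subset[OF _ fin]]) auto
  let ?x = "\<lambda>k\<in>{1..?n}. v (h k)"
  have xix: "?x (ix a) = v a" if "a \<in> T" for a
    using ix[OF that] by simp
  have "?x \<in> system_solutions ?n S"
  proof -
    have "satisfies ?x e" if "e \<in> S" for e
      using that unfolding S_def
    proof (elim UnE imageE)
      fix r assume r: "e = (case r of (a, b, c) \<Rightarrow> Mult_eq (ix a) (ix b) (ix c))" "r \<in> R"
      then obtain a b c where abc: "r = (a, b, c)" "a \<in> T" "b \<in> T" "c \<in> T" using R by blast
      have "v a * v b = v c" using v r(2) abc(1) unfolding named_solutions_def by blast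
      with r(1) abc show ?thesis by (simp only: prod.case satisfies.simps xix)
    next
      fix r assume r: "e = (case r of (a, b) \<Rightarrow> Succ_eq (ix a) (ix b))" "r \<in> Q"
      then obtain a b where ab: "r = (a, b)" "a \<in> T" "b \<in> T" using Q by blast
      have "v a + 1 = v b" using v r(2) ab(1) unfolding named_solutions_def by blast
      with r(1) ab show ?thesis by (simp only: prod.case satisfies.simps xix)
    qed
    moreover have "?x \<in> {1..?n} \<rightarrow>\<^sub>E UNIV" by simp
    ultimately show ?thesis unfolding system_solutions_def by blast
  qed
  moreover have "?n \<ge> 1" using T by (simp add: Suc_le_eq card_gt_0_iff)
  ultimately have "?x (ix t) \<le> f (2 * ?n)"
    using conj sub finS ix(1)[OF t] unfolding conjecture_A_def by blast
  then show ?thesis using xix[OF t] by simp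
qed

section \<open>Arithmetic expressions as systems of equations\<close>

datatype expr = Indet nat | Nul | Suc_of expr | Times expr expr | Plus expr expr

primrec expr_value :: "(nat \<Rightarrow> nat) \<Rightarrow> expr \<Rightarrow> nat" where
  "expr_value x (Indet i) = x i"
| "expr_value x Nul = 0"
| "expr_value x (Suc_of a) = Suc (expr_value x a)"
| "expr_value x (Times a b) = expr_value x a * expr_value x b"
| "expr_value x (Plus a b) = expr_value x a + expr_value x b"

primrec indets :: "expr \<Rightarrow> nat set" where
  "indets (Indet i) = {i}"
| "indets Nul = {}"
| "indets (Suc_of a) = indets a"
| "indets (Times a b) = indets a \<union> indets b"
| "indets (Plus a b) = indets a \<union> indets b"

primrec nodes :: "expr \<Rightarrow> nat" where
  "nodes (Indet i) = 1"
| "nodes Nul = 1"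
| "nodes (Suc_of a) = nodes a + 1"
| "nodes (Times a b) = nodes a + nodes b + 1"
| "nodes (Plus a b) = nodes a + nodes b + 1"

abbreviation "One \<equiv> Suc_of Nul"

text \<open>The two sides of the equation of \<open>robinson_addition\<close>, as expressions, for the assertion
that \<open>Plus a b\<close> has the value of \<open>a\<close> plus that of \<open>b\<close>.\<close>

definition robinson_left :: "expr \<Rightarrow> expr \<Rightarrow> expr" where
  "robinson_left a b = (let z = Suc_of (Plus a b); y = Suc_of b
     in Times (Suc_of (Times z a)) (Suc_of (Times z y)))"

definition robinson_right :: "expr \<Rightarrow> expr \<Rightarrow> expr" where
  "robinson_right a b = (let z = Suc_of (Plus a b); y = Suc_of b
     in Suc_of (Times (Times z z) (Suc_of (Times a y))))"

text \<open>The unknowns needed to state this equation with products and successors.\<close>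

definition robinson_nodes :: "expr \<Rightarrow> expr \<Rightarrow> expr set" where
  "robinson_nodes a b = (let z = Suc_of (Plus a b); y = Suc_of b
     in {Plus a b, z, y, Times z a, Suc_of (Times z a), Times z y, Suc_of (Times z y),
         robinson_left a b, Times z z, Times a y, Suc_of (Times a y),
         Times (Times z z) (Suc_of (Times a y)), robinson_right a b})"

text \<open>Robinson's definition of addition: for \<open>Z \<noteq> 0\<close> the equation
\<open>(Z x + 1) (Z Y + 1) = Z\<^sup>2 (x Y + 1) + 1\<close> says \<open>Z (x + Y) = Z\<^sup>2\<close>, hence \<open>x + Y = Z\<close>.  For \<open>Z = 0\<close>
it says nothing, so it is applied to \<open>Z = z + 1\<close> and \<open>Y = y + 1\<close>.\<close>

lemma robinson_addition:
  fixes x y z :: nat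
  assumes "(Suc z * x + 1) * (Suc z * Suc y + 1) = (Suc z * Suc z) * (x * Suc y + 1) + 1"
  shows "z = x + y"
proof -
  have "Suc z * (x + Suc y) = Suc z * Suc z"
    using assms by (simp add: algebra_simps)
  then have "x + Suc y = Suc z"
    unfolding mult_cancel1 by simp
  then show ?thesis by simp
qed

text \<open>The subexpressions of an expression together with the auxiliary ones that its sums need: the
unknowns of the system attached to it.\<close>

primrec parts :: "expr \<Rightarrow> expr set" where
  "parts (Indet i) = {Indet i}"
| "parts Nul = {Nul}"
| "parts (Suc_of a) = insert (Suc_of a) (parts a)"
| "parts (Times a b) = insert (Times a b) (parts a \<union> parts b)"
| "parts (Plus a b) = robinson_nodes a b \<union> parts a \<union> parts b"

lemma self_in_parts: "e \<in> parts e"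
  by (cases e) (auto simp: robinson_nodes_def Let_def)

lemma parts_robinson_nodes:
  assumes "e \<in> robinson_nodes a b"
  shows "parts e \<subseteq> robinson_nodes a b \<union> parts a \<union> parts b"
  using assms unfolding robinson_nodes_def Let_def
  by (elim insertE emptyE; simp add: robinson_nodes_def robinson_left_def robinson_right_def Let_def;
      blast intro: self_in_parts)

lemma parts_trans: "a \<in> parts e \<Longrightarrow> parts a \<subseteq> parts e"
proof (induction e)
  case (Plus b c)
  then consider "a \<in> robinson_nodes b c" | "a \<in> parts b" | "a \<in> parts c" by auto
  then show ?case
    using Plus.IH parts_robinson_nodes[of a b c] by cases auto
qed auto

lemma finite_parts: "finite (parts e)"
  by (induction e) (auto simp: robinson_nodes_def Let_def)

lemma card_robinson_nodes: "card (robinson_nodes a b) \<le> 13"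
  unfolding robinson_nodes_def Let_def
  by (intro card_insert_le_m1) simp_all

text \<open>A sum contributes the \<open>13\<close> nodes of its Robinson equation, every other node only itself.\<close>

lemma card_parts: "card (parts e) \<le> 13 * nodes e"
proof (induction e)
  case (Suc_of a)
  then show ?case using card_insert_le_m1[of "card (parts a) + 1" "parts a" "Suc_of a"] by simp
next
  case (Times a b)
  then show ?case
    using card_insert_le_m1[of "card (parts a \<union> parts b) + 1" "parts a \<union> parts b" "Times a b"]
      card_Un_le[of "parts a" "parts b"] by simp
next
  case (Plus a b)
  then show ?case
    using card_Un_le[of "robinson_nodes a b \<union> parts a" "parts b"]
      card_Un_le[of "robinson_nodes a b" "parts a"] card_robinson_nodes[of a b] by simp
qed auto

lemma indets_parts: "a \<in> parts e \<Longrightarrow> indets a \<subseteq> indets e"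
  by (induction e) (auto simp: robinson_nodes_def robinson_left_def robinson_right_def Let_def)

lemma expr_value_cong: "(\<And>i. i \<in> indets e \<Longrightarrow> x i = y i) \<Longrightarrow> expr_value x e = expr_value y e"
  by (induction e) auto

text \<open>The product equations of the system.  The unknown of a sum is not constrained directly but by
Robinson's equation, whose two sides are equated by a multiplication with \<open>One\<close>.  The last two
equations make \<open>Nul\<close> and \<open>One\<close> idempotent; as \<open>One\<close> is the successor of \<open>Nul\<close>, this leaves only
the value \<open>0\<close> for \<open>Nul\<close>.\<close>

definition node_products :: "expr set \<Rightarrow> (expr \<times> expr \<times> expr) set" where
  "node_products T = {(a, b, Times a b) |a b. Times a b \<in> T} \<union>
     {(robinson_left a b, One, robinson_right a b) |a b. Plus a b \<in> T} \<union>
     {(Nul, Nul, Nul), (One, One, One)}"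

definition node_successors :: "expr set \<Rightarrow> (expr \<times> expr) set" where
  "node_successors T = {(a, Suc_of a) |a. Suc_of a \<in> T}"

lemma node_products_intros:
  "Times a b \<in> T \<Longrightarrow> (a, b, Times a b) \<in> node_products T"
  "Plus a b \<in> T \<Longrightarrow> (robinson_left a b, One, robinson_right a b) \<in> node_products T"
  "(Nul, Nul, Nul) \<in> node_products T" "(One, One, One) \<in> node_products T"
  unfolding node_products_def Un_iff mem_Collect_eq by blast+

lemma child_nodes:
  assumes closed: "\<forall>e\<in>T. parts e \<subseteq> T"
  shows "Suc_of a \<in> T \<Longrightarrow> a \<in> T" "Times a b \<in> T \<Longrightarrow> a \<in> T" "Times a b \<in> T \<Longrightarrow> b \<in> T"
    "Plus a b \<in> T \<Longrightarrow> a \<in> T" "Plus a b \<in> T \<Longrightarrow> b \<in> T" "Plus a b \<in> T \<Longrightarrow> robinson_nodes a b \<subseteq> T"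
  using closed[THEN bspec, of "Suc_of a"] closed[THEN bspec, of "Times a b"]
    closed[THEN bspec, of "Plus a b"] self_in_parts[of a] self_in_parts[of b] by auto

text \<open>The equations force each node to carry the value of its expression, so a solution is determined by
the values of the indeterminates.  This is what keeps the number of solutions finite.\<close>

lemma named_solution_eq_expr_value:
  assumes closed: "\<forall>e\<in>T. parts e \<subseteq> T"
    and R: "node_products T \<subseteq> R" and Q: "node_successors T \<subseteq> Q" and one: "One \<in> T"
    and v: "v \<in> named_solutions T R Q"
  shows "e \<in> T \<Longrightarrow> v e = expr_value (\<lambda>i. v (Indet i)) e"
proof -
  note child = child_nodes[of T, OF closed]
  have prod: "v a * v b = v c" if "(a, b, c) \<in> R" for a b c
    using v that unfolding named_solutions_def by blast
  have times: "v (Times a b) = v a * v b" if "Times a b \<in> T" for a b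
  proof -
    have "(a, b, Times a b) \<in> R" by (rule subsetD[OF R node_products_intros(1)[OF that]])
    from prod[OF this] show ?thesis ..
  qed
  have succ: "v (Suc_of a) = Suc (v a)" if "Suc_of a \<in> T" for a
  proof -
    have "(a, Suc_of a) \<in> Q" using Q that unfolding node_successors_def by blast
    then have "v a + 1 = v (Suc_of a)" using v unfolding named_solutions_def by blast
    then show ?thesis by simp
  qed
  have idem: "v Nul * v Nul = v Nul" "v One * v One = v One"
    by (rule prod, rule subsetD[OF R], rule node_products_intros)+
  have nul: "v Nul = 0"
  proof -
    have "v Nul = 0 \<or> v Nul = 1" using idem(1) by (cases "v Nul = 0") simp_all
    moreover have "v Nul \<noteq> 1" using idem(2) unfolding succ[OF one] by auto
    ultimately show ?thesis by blast
  qed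
  have plus: "v (Plus a b) = v a + v b" if p: "Plus a b \<in> T" for a b
  proof (rule robinson_addition)
    have "robinson_nodes a b \<subseteq> T" by (rule child(6)[OF p])
    then have T: "Suc_of b \<in> T" "Suc_of (Plus a b) \<in> T" "robinson_left a b \<in> T" "robinson_right a b \<in> T"
      "Times (Suc_of (Plus a b)) a \<in> T" "Suc_of (Times (Suc_of (Plus a b)) a) \<in> T"
      "Times (Suc_of (Plus a b)) (Suc_of b) \<in> T" "Suc_of (Times (Suc_of (Plus a b)) (Suc_of b)) \<in> T"
      "Times (Suc_of (Plus a b)) (Suc_of (Plus a b)) \<in> T"
      "Times a (Suc_of b) \<in> T" "Suc_of (Times a (Suc_of b)) \<in> T"
      "Times (Times (Suc_of (Plus a b)) (Suc_of (Plus a b))) (Suc_of (Times a (Suc_of b))) \<in> T"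
      by (simp_all add: robinson_nodes_def Let_def)
    have "(robinson_left a b, One, robinson_right a b) \<in> R"
      by (rule subsetD[OF R node_products_intros(2)[OF p]])
    from prod[OF this] have "v (robinson_left a b) = v (robinson_right a b)"
      using succ[OF one] nul by simp
    then show "(Suc (v (Plus a b)) * v a + 1) * (Suc (v (Plus a b)) * Suc (v b) + 1) =
        Suc (v (Plus a b)) * Suc (v (Plus a b)) * (v a * Suc (v b) + 1) + 1"
      unfolding robinson_left_def robinson_right_def Let_def
      by (simp only: times succ T[unfolded robinson_left_def robinson_right_def Let_def] Suc_eq_plus1)
  qed
  show "e \<in> T \<Longrightarrow> v e = expr_value (\<lambda>i. v (Indet i)) e"
  proof (induction e)
    case (Suc_of a)
    then show ?case using child(1)[of a] succ[of a] by simp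
  next
    case (Times a b)
    then show ?case using child(2,3)[of a b] times[of a b] by simp
  next
    case (Plus a b)
    then show ?case using child(4,5)[of a b] plus[of a b] by simp
  qed (simp_all add: nul)
qed

text \<open>The unknowns are the parts of both sides, the indeterminates in \<open>U\<close>, and the constants \<open>Nul\<close> and
\<open>One\<close>.  A product equation with \<open>One\<close> states \<open>l = r\<close>.  Restricting a solution of the system to the
indeterminates is injective and gives a solution of \<open>l = r\<close>, so the system has finitely many
solutions; each solution of \<open>l = r\<close> extends to one of the system.\<close>

lemma expr_equation_bound:
  assumes conj: conjecture_A
    and U: "finite U" "indets l \<subseteq> U" "indets r \<subseteq> U"
    and fin: "finite {x \<in> U \<rightarrow>\<^sub>E UNIV. expr_value x l = expr_value x r}"
    and x: "x \<in> U \<rightarrow>\<^sub>E UNIV" "expr_value x l = expr_value x r" and i: "i \<in> U"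
  shows "\<exists>n \<le> 13 * nodes l + 13 * nodes r + card U + 2. x i \<le> f (2 * n)"
proof -
  define T where "T = parts l \<union> parts r \<union> Indet ` U \<union> {Nul, One}"
  let ?R = "node_products T \<union> {(l, One, r)}" and ?Q = "node_successors T"
  let ?sols = "{x \<in> U \<rightarrow>\<^sub>E UNIV. expr_value x l = expr_value x r}"
  have finT: "finite T" using U by (simp add: T_def finite_parts)
  have lr: "l \<in> T" "r \<in> T" and constants: "Nul \<in> T" "One \<in> T"
    by (simp_all add: T_def self_in_parts)
  have unknowns: "Indet j \<in> T" if "j \<in> U" for j
    using that by (simp add: T_def)
  have closed: "\<forall>e\<in>T. parts e \<subseteq> T"
  proof
    fix e assume "e \<in> T"
    then show "parts e \<subseteq> T"
      unfolding T_def using parts_trans[of e l] parts_trans[of e r] by auto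
  qed
  note child = child_nodes[of T, OF closed]
  have rob: "robinson_left a b \<in> T" "robinson_right a b \<in> T" if "Plus a b \<in> T" for a b
    using child(6)[OF that] unfolding robinson_nodes_def Let_def by blast+
  have R: "?R \<subseteq> T \<times> T \<times> T"
  proof
    fix t assume "t \<in> ?R"
    then consider a b where "t = (a, b, Times a b)" "Times a b \<in> T"
      | a b where "t = (robinson_left a b, One, robinson_right a b)" "Plus a b \<in> T"
      | "t = (Nul, Nul, Nul)" | "t = (One, One, One)" | "t = (l, One, r)"
      unfolding node_products_def by blast
    then show "t \<in> T \<times> T \<times> T"
    proof cases
      case 1
      with child(2,3)[OF 1(2)] show ?thesis by (simp only: mem_Sigma_iff)
    next
      case 2
      with rob[OF 2(2)] constants show ?thesis by simp
    qed (use lr constants in simp_all)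
  qed
  have Q: "?Q \<subseteq> T \<times> T"
    unfolding node_successors_def using child(1) by blast
  have ind: "indets e \<subseteq> U" if "e \<in> T" for e
    using that unfolding T_def using indets_parts[of e l] indets_parts[of e r] U by auto
  define pull where "pull v = (\<lambda>i\<in>U. v (Indet i))" for v :: "expr \<Rightarrow> nat"
  have determined: "v e = expr_value (pull v) e" if v: "v \<in> named_solutions T ?R ?Q" and e: "e \<in> T" for v e
  proof -
    have "v e = expr_value (\<lambda>i. v (Indet i)) e"
      by (rule named_solution_eq_expr_value[OF closed _ _ constants(2) v e]) auto
    also have "\<dots> = expr_value (pull v) e"
      using ind[OF e] by (intro expr_value_cong) (auto simp: pull_def)
    finally show ?thesis .
  qed
  have "inj_on pull (named_solutions T ?R ?Q)"
  proof (rule inj_onI)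
    fix v w assume vw: "v \<in> named_solutions T ?R ?Q" "w \<in> named_solutions T ?R ?Q" and eq: "pull v = pull w"
    have "v \<in> T \<rightarrow>\<^sub>E UNIV" "w \<in> T \<rightarrow>\<^sub>E UNIV"
      using vw unfolding named_solutions_def by blast+
    then show "v = w"
    proof (rule PiE_ext)
      show "v e = w e" if "e \<in> T" for e
        using determined[OF vw(1) that] determined[OF vw(2) that] eq by simp
    qed
  qed
  moreover have "pull ` named_solutions T ?R ?Q \<subseteq> ?sols"
  proof
    fix y assume "y \<in> pull ` named_solutions T ?R ?Q"
    then obtain v where v: "v \<in> named_solutions T ?R ?Q" and y: "y = pull v" by blast
    have "v l * v One = v r" using v unfolding named_solutions_def by blast
    moreover have "v One = 1" using determined[OF v constants(2)] by simp
    ultimately have "v l = v r" by simp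
    then have "expr_value (pull v) l = expr_value (pull v) r"
      using determined[OF v] lr by simp
    then show "y \<in> ?sols" by (simp add: y pull_def)
  qed
  ultimately have finN: "finite (named_solutions T ?R ?Q)"
    using fin by (meson finite_imageD finite_subset)
  let ?v = "\<lambda>e\<in>T. expr_value x e"
  have vT: "?v e = expr_value x e" if "e \<in> T" for e
    using that by (simp only: restrict_apply if_True)
  have "?v \<in> named_solutions T ?R ?Q"
  proof -
    have "?v a * ?v b = ?v c" if abc: "(a, b, c) \<in> ?R" for a b c
    proof -
      have T: "a \<in> T" "b \<in> T" "c \<in> T" using abc R by blast+
      have "expr_value x a * expr_value x b = expr_value x c"
        using abc x(2) unfolding node_products_def
        by (auto simp: robinson_left_def robinson_right_def Let_def algebra_simps)
      then show ?thesis unfolding vT[OF T(1)] vT[OF T(2)] vT[OF T(3)] .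
    qed
    moreover have "?v a + 1 = ?v b" if ab: "(a, b) \<in> ?Q" for a b
    proof -
      have T: "a \<in> T" "b \<in> T" using ab Q by blast+
      have "expr_value x a + 1 = expr_value x b" using ab unfolding node_successors_def by auto
      then show ?thesis unfolding vT[OF T(1)] vT[OF T(2)] .
    qed
    moreover have "?v \<in> T \<rightarrow>\<^sub>E UNIV" by (simp add: PiE_iff)
    ultimately show ?thesis unfolding named_solutions_def by blast
  qed
  moreover have "T \<noteq> {}" using constants by blast
  ultimately have "?v (Indet i) \<le> f (2 * card T)"
    by (intro conjecture_A_named[OF conj finT _ R Q finN] unknowns[OF i])
  then have "x i \<le> f (2 * card T)"
    unfolding vT[OF unknowns[OF i]] by simp
  moreover have "card T \<le> 13 * nodes l + 13 * nodes r + card U + 2"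
  proof -
    have "card T \<le> card (parts l) + card (parts r) + card (Indet ` U) + card {Nul, One}"
      unfolding T_def by (intro card_Un_le[THEN order_trans] add_mono order_refl)
    moreover have "card (Indet ` U) \<le> card U" by (rule card_image_le[OF U(1)])
    ultimately show ?thesis using card_parts[of l] card_parts[of r] by simp
  qed
  ultimately show ?thesis by blast
qed

section \<open>Polynomials as expressions\<close>

text \<open>Only the number of nodes and the value of an expression matter below, so its shape is left
existential, and size bounds are derived along with the values.\<close>

definition expressible :: "nat set \<Rightarrow> nat \<Rightarrow> ((nat \<Rightarrow> nat) \<Rightarrow> nat) \<Rightarrow> bool" where
  "expressible U w F \<longleftrightarrow> (\<exists>e. indets e \<subseteq> U \<and> nodes e \<le> w \<and> (\<forall>x. expr_value x e = F x))"

lemma expressible_mono: "expressible U v F \<Longrightarrow> v \<le> w \<Longrightarrow> expressible U w F"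
  unfolding expressible_def using order_trans by blast

lemma expressible_const: "expressible U (k + 1) (\<lambda>_. k)"
proof (induction k)
  case 0
  show ?case unfolding expressible_def by (intro exI[of _ Nul]) simp
next
  case (Suc k)
  then obtain e where "indets e \<subseteq> U" "nodes e \<le> k + 1" "\<forall>x. expr_value x e = k"
    unfolding expressible_def by blast
  then show ?case unfolding expressible_def by (intro exI[of _ "Suc_of e"]) simp
qed

lemma expressible_var: "i \<in> U \<Longrightarrow> expressible U 1 (\<lambda>x. x i)"
  unfolding expressible_def by (intro exI[of _ "Indet i"]) simp

lemma expressible_times:
  assumes "expressible U v F" "expressible U w H"
  shows "expressible U (v + w + 1) (\<lambda>x. F x * H x)"
proof -
  obtain a b where "indets a \<subseteq> U" "nodes a \<le> v" "\<forall>x. expr_value x a = F x"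
    "indets b \<subseteq> U" "nodes b \<le> w" "\<forall>x. expr_value x b = H x"
    using assms unfolding expressible_def by blast
  then show ?thesis unfolding expressible_def by (intro exI[of _ "Times a b"]) simp
qed

lemma expressible_plus:
  assumes "expressible U v F" "expressible U w H"
  shows "expressible U (v + w + 1) (\<lambda>x. F x + H x)"
proof -
  obtain a b where "indets a \<subseteq> U" "nodes a \<le> v" "\<forall>x. expr_value x a = F x"
    "indets b \<subseteq> U" "nodes b \<le> w" "\<forall>x. expr_value x b = H x"
    using assms unfolding expressible_def by blast
  then show ?thesis unfolding expressible_def by (intro exI[of _ "Plus a b"]) simp
qed

lemma expressible_power: "i \<in> U \<Longrightarrow> expressible U (2 * n + 2) (\<lambda>x. x i ^ n)"
proof (induction n)
  case 0
  show ?case using expressible_const[of U 1] by simp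
next
  case (Suc n)
  then show ?case
    using expressible_times[OF expressible_var[OF Suc.prems] Suc.IH[OF Suc.prems]] by simp
qed

lemma expressible_prod:
  assumes "finite K" "\<And>k. k \<in> K \<Longrightarrow> expressible U w (F k)"
  shows "expressible U (card K * (w + 1) + 2) (\<lambda>x. \<Prod>k\<in>K. F k x)"
  using assms
proof (induction rule: finite_induct)
  case empty
  show ?case using expressible_const[of U 1] by simp
next
  case (insert k K)
  then have "expressible U (w + (card K * (w + 1) + 2) + 1) (\<lambda>x. F k x * (\<Prod>k\<in>K. F k x))"
    by (intro expressible_times) auto
  with insert.hyps show ?case by (simp add: algebra_simps)
qed

lemma expressible_sum:
  assumes "finite K" "\<And>k. k \<in> K \<Longrightarrow> expressible U w (F k)"
  shows "expressible U (card K * (w + 1) + 1) (\<lambda>x. \<Sum>k\<in>K. F k x)"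
  using assms
proof (induction rule: finite_induct)
  case empty
  show ?case using expressible_const[of U 0] by simp
next
  case (insert k K)
  then have "expressible U (w + (card K * (w + 1) + 1) + 1) (\<lambda>x. F k x + (\<Sum>k\<in>K. F k x))"
    by (intro expressible_plus) auto
  with insert.hyps show ?case by (simp add: algebra_simps)
qed

text \<open>Moving the negative terms to the other side turns \<open>D = 0\<close> into an equation between two polynomials
with coefficients in the natural numbers.\<close>

definition positive_part :: "int_mpoly \<Rightarrow> (nat \<Rightarrow> nat) \<Rightarrow> nat" where
  "positive_part D x = (\<Sum>m\<in>keys D. nat (lookup D m) * (\<Prod>i\<in>keys m. x i ^ lookup m i))"

definition negative_part :: "int_mpoly \<Rightarrow> (nat \<Rightarrow> nat) \<Rightarrow> nat" where
  "negative_part D x = (\<Sum>m\<in>keys D. nat (- lookup D m) * (\<Prod>i\<in>keys m. x i ^ lookup m i))"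

lemma insertion_int: "insertion (\<lambda>i. int (x i)) D = int (positive_part D x) - int (negative_part D x)"
proof -
  have "lookup D m = int (nat (lookup D m)) - int (nat (- lookup D m))" for m by simp
  then have "insertion (\<lambda>i. int (x i)) D =
      (\<Sum>m\<in>keys D. (int (nat (lookup D m)) - int (nat (- lookup D m))) * (\<Prod>i\<in>keys m. int (x i) ^ lookup m i))"
    unfolding insertion_def by (intro sum.cong) simp_all
  then show ?thesis
    by (simp add: positive_part_def negative_part_def left_diff_distrib sum_subtractf)
qed

text \<open>Bound for the size of either side in terms of the code \<open>c\<close> of the polynomial: at most \<open>c\<close> terms,
each with a coefficient at most \<open>c\<close> and at most \<open>c\<close> powers, each exponent being at most \<open>c\<close>.\<close>

definition expression_size :: "nat \<Rightarrow> nat" where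
  "expression_size c = c * ((c + 1 + (c * ((2 * c + 2) + 1) + 2) + 1) + 1) + 1"

lemma card_le_set_encode: "finite A \<Longrightarrow> card A \<le> set_encode A"
proof -
  assume "finite A"
  have "card A = (\<Sum>a\<in>A. 1)" by simp
  also have "\<dots> \<le> set_encode A" unfolding set_encode_def by (intro sum_mono) simp
  finally show ?thesis .
qed

lemma card_keys_le_code_monom: "card (keys m) \<le> code_monom m"
proof -
  have "card (keys m) = card ((\<lambda>i. prod_encode (i, lookup m i)) ` keys m)"
    by (rule card_image[symmetric]) (auto simp: inj_on_def)
  then show ?thesis unfolding code_monom_def by (simp add: card_le_set_encode)
qed

lemma card_keys_le_code_mpoly: "card (keys D) \<le> code_mpoly D"
proof -
  have "card (keys D) = card ((\<lambda>m. prod_encode (code_monom m, int_encode (lookup D m))) ` keys D)"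
    by (rule card_image[symmetric]) (auto simp: inj_on_def inj_eq[OF inj_code_monom])
  then show ?thesis unfolding code_mpoly_def by (simp add: card_le_set_encode)
qed

lemma lookup_le_code_monom: "lookup m i \<le> code_monom m"
proof (cases "i \<in> keys m")
  case True
  have "lookup m i \<le> prod_encode (i, lookup m i)" by (rule le_prod_encode_2)
  also have "\<dots> < code_monom m"
    unfolding code_monom_def using True by (intro mem_less_set_encode) auto
  finally show ?thesis by simp
qed (simp add: in_keys_iff)

lemma coeff_le_code_mpoly:
  assumes "m \<in> keys D"
  shows "nat \<bar>lookup D m\<bar> \<le> code_mpoly D"
proof -
  have "nat \<bar>z\<bar> \<le> int_encode z" for z
    by (auto simp: int_encode_def sum_encode_def)
  also have "int_encode (lookup D m) \<le> prod_encode (code_monom m, int_encode (lookup D m))"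
    by (rule le_prod_encode_2)
  also have "\<dots> < code_mpoly D"
    unfolding code_mpoly_def using assms by (intro mem_less_set_encode) auto
  finally show ?thesis by simp
qed

lemma expressible_combination:
  assumes vars: "vars D \<subseteq> U" and coeff: "\<And>m. m \<in> keys D \<Longrightarrow> k m \<le> code_mpoly D"
  shows "expressible U (expression_size (code_mpoly D))
    (\<lambda>x. \<Sum>m\<in>keys D. k m * (\<Prod>i\<in>keys m. x i ^ lookup m i))"
proof -
  let ?c = "code_mpoly D"
  have "expressible U (?c + 1 + (?c * ((2 * ?c + 2) + 1) + 2) + 1)
      (\<lambda>x. k m * (\<Prod>i\<in>keys m. x i ^ lookup m i))" if m: "m \<in> keys D" for m
  proof (rule expressible_times)
    show "expressible U (?c + 1) (\<lambda>_. k m)"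
      by (rule expressible_mono[OF expressible_const]) (simp add: coeff[OF m])
    have mc: "code_monom m \<le> ?c" using code_monom_less_code_mpoly[OF m] by simp
    have "expressible U (card (keys m) * ((2 * ?c + 2) + 1) + 2) (\<lambda>x. \<Prod>i\<in>keys m. x i ^ lookup m i)"
    proof (rule expressible_prod)
      fix i assume "i \<in> keys m"
      then have "i \<in> U" using vars m by (auto simp: vars_def)
      then show "expressible U (2 * ?c + 2) (\<lambda>x. x i ^ lookup m i)"
        using lookup_le_code_monom[of m i] mc by (intro expressible_mono[OF expressible_power]) auto
    qed simp
    then show "expressible U (?c * ((2 * ?c + 2) + 1) + 2) (\<lambda>x. \<Prod>i\<in>keys m. x i ^ lookup m i)"
      by (rule expressible_mono)
         (intro add_mono mult_right_mono order_refl order_trans[OF card_keys_le_code_monom mc], simp)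
  qed
  then have "expressible U (card (keys D) * ((?c + 1 + (?c * ((2 * ?c + 2) + 1) + 2) + 1) + 1) + 1)
      (\<lambda>x. \<Sum>m\<in>keys D. k m * (\<Prod>i\<in>keys m. x i ^ lookup m i))"
    by (intro expressible_sum) simp_all
  then show ?thesis
    unfolding expression_size_def
    by (rule expressible_mono) (intro add_mono mult_right_mono order_refl card_keys_le_code_mpoly, simp)
qed

section \<open>The bounding algorithm\<close>

lemma mono_f: "mono f"
proof (rule mono_iff_le_Suc[THEN iffD2], rule allI)
  fix n
  have "f (Suc n) \<le> 2 ^ 2 ^ f (Suc n)"
    by (rule order.trans; rule less_imp_le[OF less_exp])
  then show "f n \<le> f (Suc n)"
    by (cases n) simp_all
qed

lemma recursive_f [rec_intros]:
  assumes "recursive n a"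
  shows "recursive n (\<lambda>xs. f (a xs))"
proof (rule recursive_compose1[where F = f, OF _ assms])
  have "rec_nat 0 (\<lambda>i y. if i = 0 then 1 else 2 ^ 2 ^ y) x = f x" for x
  proof (induction x)
    case (Suc x)
    then show ?case by (cases x) simp_all
  qed simp
  moreover have "recursive 1 (\<lambda>ys. rec_nat 0 (\<lambda>i y. if i = 0 then 1 else 2 ^ 2 ^ y) (hd ys))"
    by (intro rec_intros) simp_all
  ultimately show "recursive 1 (\<lambda>ys. f (hd ys))" by simp
qed

text \<open>Two sides with at most \<open>13\<close> unknowns for each node (\<open>card_parts\<close>), the unknowns of the equation
itself, and two constants.\<close>

definition unknowns_bound :: "equation \<Rightarrow> nat" where
  "unknowns_bound E = 26 * expression_size (code_mpoly (snd E)) + fst E + 2"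

lemma nonneg_solution_bound:
  assumes conj: conjecture_A and E: "diophantine E" and fin: "finite (solutions \<nat> E)"
    and y: "y \<in> solutions \<nat> E" and i: "i \<in> {1..fst E}"
  shows "y i \<le> int (f (2 * unknowns_bound E))"
proof -
  let ?I = "{1..fst E}" and ?D = "snd E"
  let ?w = "expression_size (code_mpoly ?D)"
  have vars: "vars ?D \<subseteq> ?I" using E by (simp add: diophantine_def)
  have small: "nat (lookup ?D m) \<le> code_mpoly ?D" "nat (- lookup ?D m) \<le> code_mpoly ?D"
    if "m \<in> keys ?D" for m
    using coeff_le_code_mpoly[OF that] by auto
  have "expressible ?I ?w (positive_part ?D)" "expressible ?I ?w (negative_part ?D)"
    unfolding positive_part_def[abs_def] negative_part_def[abs_def]
    by (rule expressible_combination[OF vars], erule small)+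
  then obtain l r where l: "indets l \<subseteq> ?I" "nodes l \<le> ?w" "\<And>x. expr_value x l = positive_part ?D x"
    and r: "indets r \<subseteq> ?I" "nodes r \<le> ?w" "\<And>x. expr_value x r = negative_part ?D x"
    unfolding expressible_def by blast
  have eq: "expr_value x l = expr_value x r \<longleftrightarrow> insertion (\<lambda>i. int (x i)) ?D = 0" for x
    unfolding l(3) r(3) insertion_int by simp
  define push where "push x = (\<lambda>i\<in>?I. int (x i))" for x :: "nat \<Rightarrow> nat"
  have ins: "insertion (push x) ?D = insertion (\<lambda>i. int (x i)) ?D" for x
    using vars by (intro insertion_cong) (auto simp: push_def)
  let ?sols = "{x \<in> ?I \<rightarrow>\<^sub>E UNIV. expr_value x l = expr_value x r}"
  have "push ` ?sols \<subseteq> solutions \<nat> E"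
  proof
    fix z assume "z \<in> push ` ?sols"
    then obtain x where x: "z = push x" "expr_value x l = expr_value x r" by blast
    have "push x \<in> ?I \<rightarrow>\<^sub>E \<nat>" by (simp add: push_def PiE_iff)
    with x show "z \<in> solutions \<nat> E" unfolding solutions_def by (simp add: eq ins)
  qed
  moreover have "inj_on push ?sols"
  proof (rule inj_onI)
    fix x x' assume xx': "x \<in> ?sols" "x' \<in> ?sols" and eq: "push x = push x'"
    then have "x \<in> ?I \<rightarrow>\<^sub>E UNIV" "x' \<in> ?I \<rightarrow>\<^sub>E UNIV" by blast+
    then show "x = x'"
    proof (rule PiE_ext)
      show "x k = x' k" if "k \<in> ?I" for k
        using fun_cong[OF eq, of k] that by (simp add: push_def)
    qed
  qed
  ultimately have finS: "finite ?sols"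
    using fin by (meson finite_imageD finite_subset)
  define x where "x = (\<lambda>i\<in>?I. nat (y i))"
  have yP: "y \<in> ?I \<rightarrow>\<^sub>E \<nat>" and y0: "insertion y ?D = 0" using y unfolding solutions_def by blast+
  have yx: "int (x k) = y k" if "k \<in> ?I" for k
    using PiE_mem[OF yP that] that by (auto simp: x_def Nats_altdef2)
  have "insertion (\<lambda>i. int (x i)) ?D = insertion y ?D"
    using vars yx by (intro insertion_cong) blast
  then have "expr_value x l = expr_value x r" using y0 by (simp add: eq)
  moreover have "x \<in> ?I \<rightarrow>\<^sub>E UNIV" by (simp add: x_def)
  ultimately obtain n where n: "n \<le> 13 * nodes l + 13 * nodes r + card ?I + 2" "x i \<le> f (2 * n)"
    using expr_equation_bound[OF conj _ l(1) r(1) finS _ _ i] by blast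
  have "2 * n \<le> 2 * unknowns_bound E"
    using n(1) l(2) r(2) by (simp add: unknowns_bound_def)
  then have "x i \<le> f (2 * unknowns_bound E)"
    using n(2) monoD[OF mono_f] order_trans by blast
  then show ?thesis using yx[OF i] by linarith
qed

text \<open>The bound depends on the equation only through the two components of its code, and \<open>f\<close> is
primitive recursive.\<close>

lemma nonneg_bounding_algorithm_unknowns_bound:
  assumes conjecture_A
  shows "nonneg_bounding_algorithm (\<lambda>E. int (f (2 * unknowns_bound E)))"
  unfolding nonneg_bounding_algorithm_def
proof (intro conjI allI impI ballI)
  let ?F = "\<lambda>xs. int_encode (int (f (2 * (26 * expression_size (snd (prod_decode (hd xs))) + fst (prod_decode (hd xs)) + 2))))"
  have "recursive 1 ?F"
    unfolding expression_size_def by (intro rec_intros) simp_all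
  then obtain q where q: "\<And>xs. length xs = 1 \<Longrightarrow> evaluates q xs (?F xs)"
    unfolding recursive_def by blast
  have F: "?F [code_equation E] = int_encode (int (f (2 * unknowns_bound E)))" for E
    unfolding unknowns_bound_def code_equation_def
    by (simp only: list.sel prod_encode_inverse fst_conv snd_conv)
  have "evaluates q [code_equation E] (int_encode (int (f (2 * unknowns_bound E))))" for E
    using q[of "[code_equation E]"] unfolding F by simp
  then show "computable (\<lambda>E. int (f (2 * unknowns_bound E)))"
    unfolding computable_def by blast
qed (rule nonneg_solution_bound[OF assms])

theorem theorem3:
  assumes conjecture_A
  shows "(\<exists>B. integer_bounding_algorithm B) \<and>
         (\<forall>A. nonneg_bounding_algorithm A \<longrightarrow>
              integer_bounding_algorithm (\<lambda>D. A (sign_product D)))"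
  using nonneg_bounding_algorithm_unknowns_bound[OF assms] integer_bounding_algorithm_sign_product
  by blast

end
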